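(* Let $d=1$ and let $Q$ be a probability measure on $\Omega=\{0,1\}^{\mathbb{Z}}$ such that (1) $Q$ is stationary and ergodic with respect to the shift $\theta_1$, and (2) $Q(\mathcal{P}(\omega)=\emptyset)<1$. Then $\mathbb{E}_P[f_1]<\infty$, and for $P$-almost every $\omega\in\Omega_0$, under the quenched law $P_\omega$, $$\frac{X_n}{\sqrt n}\longrightarrow N\big(0,(\mathbb{E}_P[f_1])^2\big)\quad\text{in distribution as } n\to\infty,$$ where $N(0,a^2)$ denotes the normal distribution with mean zero and variance $a^2$.
   Context: Setting (with $d=1$). $\Omega=\{0,1\}^{\mathbb{Z}}$ carries its product Borel $\sigma$-algebra. For $x\in\mathbb{Z}$, $(\theta_x\omega)(y)=\omega(x+y)$. $\mathcal{P}(\omega)=\{x\in\mathbb{Z}:\omega(x)=1\}$. $\Omega_0=\{\omega:\omega(0)=1\}$; under (1),(2) one has $Q(\Omega_0)>0$, and $P(\cdot)=Q(\cdot\mid\Omega_0)$ with expectation $\mathbb{E}_P$. For $e\in\{1,-1\}$, $f_e(\omega)=\min\{k>0:\omega(ke)=1\}$ (for $Q$-a.e. $\omega$, $f_e(\theta_v\omega)<\infty$ for all $v,e$). The coordinate nearest neighbors of $v$ are $N_v(\omega)=\{v+f_1(\theta_v\omega),\,v-f_{-1}(\theta_v\omega)\}$. For $P$-a.e. $\omega\in\Omega_0$, $P_\omega$ (quenched law) is the law of the Markov chain $(X_n)_{n\ge0}$ on $\mathcal{P}(\omega)$ with $P_\omega(X_0=0)=1$ and $P_\omega(X_{n+1}=u\mid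 X_n=v)=\frac12$ if $u\in N_v(\omega)$ and $0$ otherwise. *)

theory Defs
  imports "HOL-Probability.Probability"
begin

section \<open>Environments\<close>

text \<open>
  \<open>{0,1}\<close> is rendered as \<^typ>\<open>bool\<close>, so \<open>\<omega>(x) = 1\<close> is \<open>\<omega> x\<close> and
  \<open>\<Omega>\<close> is \<^typ>\<open>int \<Rightarrow> bool\<close>.
\<close>

type_synonym env = "int \<Rightarrow> bool"

definition env_algebra :: "env measure" where
  "env_algebra = (\<Pi>\<^sub>M x\<in>UNIV. count_space UNIV)"

definition shift :: "int \<Rightarrow> env \<Rightarrow> env" where
  "shift x \<omega> = (\<lambda>y. \<omega> (x + y))"

definition points :: "env \<Rightarrow> int set" where
  "points \<omega> = {x. \<omega> x}"

definition Omega0 :: "env set" where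
  "Omega0 = {\<omega>. \<omega> 0}"

definition stationary :: "('a \<Rightarrow> 'a) \<Rightarrow> 'a measure \<Rightarrow> bool" where
  "stationary T M \<longleftrightarrow> T \<in> M \<rightarrow>\<^sub>M M \<and> distr M M T = M"

definition ergodic :: "('a \<Rightarrow> 'a) \<Rightarrow> 'a measure \<Rightarrow> bool" where
  "ergodic T M \<longleftrightarrow>
     (\<forall>A\<in>sets M. T -` A \<inter> space M = A \<longrightarrow> measure M A = 0 \<or> measure M A = 1)"

text \<open>The measure \<open>P = Q(\<cdot> | \<Omega>\<^sub>0)\<close>.\<close>

definition palm :: "env measure \<Rightarrow> env measure" where
  "palm Q = uniform_measure Q Omega0"

text \<open>
  \<open>f\<^sub>e\<close> takes the value \<open>\<infinity>\<close> when there is no point in direction \<open>e\<close>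
  (the infimum of the empty set).
\<close>

definition gap :: "int \<Rightarrow> env \<Rightarrow> enat" where
  "gap e \<omega> = (INF k\<in>{k::nat. k > 0 \<and> \<omega> (int k * e)}. enat k)"

text \<open>
  \<open>E\<^sub>P[f\<^sub>1]\<close>, as an extended nonnegative number, so that finiteness is a genuine claim.
\<close>

definition mean_gap :: "env measure \<Rightarrow> ennreal" where
  "mean_gap Q = (\<integral>\<^sup>+ \<omega>. ennreal_of_enat (gap 1 \<omega>) \<partial>palm Q)"

text \<open>Only meaningful when both gaps at \<open>v\<close> are finite, since \<open>the_enat \<infinity>\<close> is unspecified.\<close>

definition neighbours :: "env \<Rightarrow> int \<Rightarrow> int set" where
  "neighbours \<omega> v =
     {v + int (the_enat (gap 1 (shift v \<omega>))), v - int (the_enat (gap (-1) (shift v \<omega>)))}"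


section \<open>Markov chains and the quenched law\<close>

text \<open>
  \<open>L\<close> is the law, on the space of trajectories, of a Markov chain started at \<open>s\<close> with
  transition probabilities \<open>p\<close>. The Markov property is included by conditioning on the
  whole history.
\<close>

definition markov_chain_law ::
    "('s \<Rightarrow> 's \<Rightarrow> real) \<Rightarrow> 's \<Rightarrow> (nat \<Rightarrow> 's) measure \<Rightarrow> bool" where
  "markov_chain_law p s L \<longleftrightarrow>
     prob_space L \<and> sets L = sets (\<Pi>\<^sub>M n\<in>UNIV. count_space UNIV) \<and>
     \<P>(X in L. X 0 = s) = 1 \<and>
     (\<forall>n x u. \<P>(X in L. \<forall>i\<le>n. X i = x i) \<noteq> 0 \<longrightarrow>
        \<P>(X in L. X (Suc n) = u \<bar> \<forall>i\<le>n. X i = x i) = p (x n) u)"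

definition trans_prob :: "env \<Rightarrow> int \<Rightarrow> int \<Rightarrow> real" where
  "trans_prob \<omega> v u = (if u \<in> neighbours \<omega> v then 1/2 else 0)"

text \<open>
  The walk is viewed as a chain on all of \<open>\<int>\<close>; started at \<open>0 \<in> points \<omega>\<close> it stays in
  \<open>points \<omega>\<close>. The law exists and is unique whenever all gaps are finite, see
  \<open>quenched_law_well_defined\<close> and \<open>quenched_law_in_points\<close> below.
\<close>

definition quenched_law :: "env \<Rightarrow> (nat \<Rightarrow> int) measure" where
  "quenched_law \<omega> = (THE L. markov_chain_law (trans_prob \<omega>) 0 L)"


section \<open>Well-definedness of the quenched law\<close>

lemma path_sets:
  fixes L :: "(nat \<Rightarrow> 's::countable) measure"
  assumes "sets L = sets (\<Pi>\<^sub>M n\<in>UNIV. count_space UNIV)"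
  shows "{X\<in>space L. \<forall>i\<le>n. X i = x i} \<in> sets L"
    and "{X\<in>space L. X (Suc n) = u \<and> (\<forall>i\<le>n. X i = x i)} \<in> sets L"
    and "{X\<in>space L. X n = u} \<in> sets L"
proof -
  have [measurable]: "(\<lambda>X. X i) \<in> measurable L (count_space UNIV)" for i
    using measurable_cong_sets[OF assms refl] measurable_component_singleton[of i UNIV]
    by blast
  show "{X\<in>space L. \<forall>i\<le>n. X i = x i} \<in> sets L"
    and "{X\<in>space L. X (Suc n) = u \<and> (\<forall>i\<le>n. X i = x i)} \<in> sets L"
    and "{X\<in>space L. X n = u} \<in> sets L"
    by measurable
qed

lemma path_prob:
  fixes p :: "'s::countable \<Rightarrow> 's \<Rightarrow> real"
  assumes "markov_chain_law p s L"
  shows "\<P>(X in L. \<forall>i\<le>n. X i = x i) =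
    (if x 0 = s then 1 else 0) * (\<Prod>i<n. p (x i) (x (Suc i)))"
proof (induction n)
  interpret prob_space L using assms by (simp add: markov_chain_law_def)
  have S: "sets L = sets (\<Pi>\<^sub>M n\<in>UNIV. count_space UNIV)"
    and init: "\<P>(X in L. X 0 = s) = 1"
    using assms by (auto simp: markov_chain_law_def)
  case 0
  show ?case
  proof (cases "x 0 = s")
    case True
    then show ?thesis using init by simp
  next
    case False
    have "AE X in L. X 0 = s"
      using init path_sets(3)[OF S, of 0 s] by (simp add: prob_Collect_eq_1)
    then have "AE X in L. X 0 \<noteq> x 0" using False by auto
    then have "\<P>(X in L. X 0 = x 0) = 0"
      using path_sets(3)[OF S, of 0 "x 0"] by (subst prob_Collect_eq_0) auto
    then show ?thesis using False by simp
  qed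
next
  interpret prob_space L using assms by (simp add: markov_chain_law_def)
  have S: "sets L = sets (\<Pi>\<^sub>M n\<in>UNIV. count_space UNIV)"
    using assms by (auto simp: markov_chain_law_def)
  case (Suc n)
  let ?h = "\<P>(X in L. \<forall>i\<le>n. X i = x i)"
  have eq: "\<P>(X in L. \<forall>i\<le>Suc n. X i = x i) =
      \<P>(X in L. X (Suc n) = x (Suc n) \<and> (\<forall>i\<le>n. X i = x i))"
    by (intro arg_cong[where f="measure L"]) (auto simp: le_Suc_eq)
  have "\<P>(X in L. X (Suc n) = x (Suc n) \<and> (\<forall>i\<le>n. X i = x i)) = ?h * p (x n) (x (Suc n))"
  proof (cases "?h = 0")
    case True
    have "\<P>(X in L. X (Suc n) = x (Suc n) \<and> (\<forall>i\<le>n. X i = x i)) \<le> ?h"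
      by (rule finite_measure_mono[OF _ path_sets(1)[OF S]]) blast
    then have "\<P>(X in L. X (Suc n) = x (Suc n) \<and> (\<forall>i\<le>n. X i = x i)) = 0"
      unfolding True by (simp only: measure_le_0_iff)
    then show ?thesis unfolding True by simp
  next
    case False
    then have "\<P>(X in L. X (Suc n) = x (Suc n) \<bar> \<forall>i\<le>n. X i = x i) = p (x n) (x (Suc n))"
      using assms by (auto simp: markov_chain_law_def)
    with False show ?thesis by (simp add: cond_prob_def field_simps)
  qed
  with eq Suc show ?case by simp
qed

lemma markov_chain_law_unique:
  fixes p :: "'s::countable \<Rightarrow> 's \<Rightarrow> real"
  assumes L: "markov_chain_law p s L" and K: "markov_chain_law p s K"
  shows "L = K"
proof -
  interpret L: prob_space L using L by (simp add: markov_chain_law_def)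
  interpret K: prob_space K using K by (simp add: markov_chain_law_def)
  have SL: "sets L = sets (\<Pi>\<^sub>M n\<in>UNIV. count_space UNIV)"
    and SK: "sets K = sets (\<Pi>\<^sub>M n\<in>UNIV. count_space UNIV)"
    using L K by (auto simp: markov_chain_law_def)
  have spL: "space L = UNIV" and spK: "space K = UNIV"
    using sets_eq_imp_space_eq[OF SL] sets_eq_imp_space_eq[OF SK] by (auto simp: space_PiM)
  have decomp: "emeasure M {X. \<forall>i\<le>n. X i \<in> B i} =
      (\<integral>\<^sup>+ l. emeasure M {X. \<forall>i\<le>n. X i = l ! i}
         \<partial>count_space {l. length l = Suc n \<and> (\<forall>i\<le>n. l ! i \<in> B i)})"
    if S: "sets M = sets (\<Pi>\<^sub>M n\<in>UNIV. count_space UNIV)"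
    for M :: "(nat \<Rightarrow> 's) measure" and B :: "nat \<Rightarrow> 's set" and n
  proof -
    let ?I = "{l. length l = Suc n \<and> (\<forall>i\<le>n. l ! i \<in> B i)}"
    have sp: "space M = UNIV"
      using sets_eq_imp_space_eq[OF S] by (auto simp: space_PiM)
    have U: "{X. \<forall>i\<le>n. X i \<in> B i} = (\<Union>l\<in>?I. {X. \<forall>i\<le>n. X i = l ! i})"
    proof safe
      fix X :: "nat \<Rightarrow> 's" assume "\<forall>i\<le>n. X i \<in> B i"
      then show "X \<in> (\<Union>l\<in>?I. {X. \<forall>i\<le>n. X i = l ! i})"
        by (intro UN_I[of "map X [0..<Suc n]"]) (auto simp del: upt_Suc)
    qed auto
    show ?thesis unfolding U
    proof (rule emeasure_UN_countable)
      show "{X. \<forall>i\<le>n. X i = l ! i} \<in> sets M" for l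
        using path_sets(1)[OF S, of n "\<lambda>i. l ! i"] by (simp add: sp)
      show "disjoint_family_on (\<lambda>l. {X. \<forall>i\<le>n. X i = l ! i}) ?I"
      proof (unfold disjoint_family_on_def, intro ballI impI)
        fix l l' assume "l \<in> ?I" "l' \<in> ?I" "l \<noteq> l'"
        then obtain i where "i \<le> n" "l ! i \<noteq> l' ! i"
          by (auto simp: list_eq_iff_nth_eq less_Suc_eq_le)
        then show "{X. \<forall>i\<le>n. X i = l ! i} \<inter> {X. \<forall>i\<le>n. X i = l' ! i} = {}"
          by auto
      qed
    qed auto
  qed
  show ?thesis
  proof (rule measure_eqI_PiM_infinite[OF SL SK])
    show "finite_measure L" by unfold_locales
    fix A :: "nat \<Rightarrow> 's set" and J :: "nat set"
    assume J: "finite J"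
    then obtain n where n: "J \<subseteq> {..n}"
      by (meson finite_nat_iff_bounded_le)
    define B where "B i = (if i \<in> J then A i else UNIV)" for i
    have e: "prod_emb UNIV (\<lambda>_. count_space UNIV) J (Pi\<^sub>E J A) = {X. \<forall>i\<le>n. X i \<in> B i}"
    proof (rule set_eqI)
      fix X :: "nat \<Rightarrow> 's"
      have "X \<in> prod_emb UNIV (\<lambda>_. count_space UNIV) J (Pi\<^sub>E J A) \<longleftrightarrow> (\<forall>i\<in>J. X i \<in> A i)"
        by (simp add: prod_emb_def PiE_iff)
      also have "\<dots> \<longleftrightarrow> (\<forall>i\<le>n. X i \<in> B i)"
        using n unfolding B_def by fastforce
      finally show "X \<in> prod_emb UNIV (\<lambda>_. count_space UNIV) J (Pi\<^sub>E J A) \<longleftrightarrow>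
          X \<in> {X. \<forall>i\<le>n. X i \<in> B i}" by simp
    qed
    have "emeasure L {X. \<forall>i\<le>n. X i = l ! i} = emeasure K {X. \<forall>i\<le>n. X i = l ! i}" for l
      using path_prob[OF L, of n "\<lambda>i. l ! i"] path_prob[OF K, of n "\<lambda>i. l ! i"]
      by (simp add: L.emeasure_eq_measure K.emeasure_eq_measure spL spK)
    then show "emeasure L (prod_emb UNIV (\<lambda>_. count_space UNIV) J (Pi\<^sub>E J A)) =
        emeasure K (prod_emb UNIV (\<lambda>_. count_space UNIV) J (Pi\<^sub>E J A))"
      unfolding e decomp[OF SL] decomp[OF SK] by simp
  qed
qed

lemma markov_chain_law_exists:
  fixes K :: "'s::countable \<Rightarrow> 's pmf"
  shows "\<exists>L. markov_chain_law (\<lambda>v. pmf (K v)) s L"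
proof -
  define P :: "nat \<Rightarrow> (nat \<Rightarrow> 's) \<Rightarrow> 's measure" where
    "P n x = measure_pmf (case n of 0 \<Rightarrow> return_pmf s | Suc m \<Rightarrow> K (x m))" for n x
  define M where "M = (\<lambda>_::nat. count_space (UNIV::'s set))"
  interpret IT: Ionescu_Tulcea P M
  proof (rule Ionescu_Tulcea.intro)
    show "P i \<in> measurable (Pi\<^sub>M {0..<i} M) (subprob_algebra (M i))" for i
    proof (cases i)
      case 0
      have "P 0 = (\<lambda>_. measure_pmf (return_pmf s))" by (simp add: P_def fun_eq_iff)
      moreover have "measure_pmf (return_pmf s) \<in> space (subprob_algebra (M i))"
        unfolding M_def by (rule measure_pmf_in_subprob_algebra)
      ultimately show ?thesis unfolding 0 by (simp only: measurable_const)
    next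
      case (Suc m)
      have "(\<lambda>x. x m) \<in> measurable (Pi\<^sub>M {0..<i} M) (count_space UNIV)"
        using measurable_component_singleton[of m "{0..<i}" M] Suc by (simp add: M_def)
      moreover have "(\<lambda>v. measure_pmf (K v)) \<in>
          measurable (count_space UNIV) (subprob_algebra (count_space UNIV))"
        by (simp add: measure_pmf_in_subprob_algebra)
      moreover have "P i = (\<lambda>x. measure_pmf (K (x m)))" by (simp add: P_def fun_eq_iff Suc)
      ultimately show ?thesis
        using measurable_compose[of "\<lambda>x. x m" "Pi\<^sub>M {0..<i} M" "count_space UNIV"
            "\<lambda>v. measure_pmf (K v)"] by (simp add: M_def)
    qed
    show "prob_space (P i x)" if "x \<in> space (Pi\<^sub>M {0..<i} M)" for i x
      by (simp add: P_def measure_pmf.prob_space_axioms)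
  qed
  define L where "L = IT.PF.lim"
  have S: "sets L = sets (\<Pi>\<^sub>M n\<in>UNIV. count_space UNIV)"
    unfolding L_def IT.PF.sets_lim by (simp add: M_def)
  have spL: "space L = UNIV"
    unfolding L_def IT.PF.space_lim by (simp add: M_def space_PiM)
  have single: "{restrict x {0..<n}} \<in> sets (PiM {0..<n} M)" for x :: "nat \<Rightarrow> 's" and n
  proof -
    have "{restrict x {0..<n}} = (\<Pi>\<^sub>E i\<in>{0..<n}. {x i})"
      by (auto simp: PiE_iff fun_eq_iff restrict_def extensional_def)
    also have "\<dots> \<in> sets (PiM {0..<n} M)"
      by (intro sets_PiM_I_finite) (auto simp: M_def)
    finally show ?thesis .
  qed
  have path: "emeasure L {X. \<forall>i<n. X i = x i} =
      emeasure (IT.C 0 n (\<lambda>_. undefined)) {restrict x {0..<n}}" for x n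
  proof -
    have "{X. \<forall>i<n. X i = x i} = IT.PF.emb UNIV {0..<n} {restrict x {0..<n}}"
      by (auto simp: prod_emb_def M_def fun_eq_iff restrict_def) metis
    then have "emeasure L {X. \<forall>i<n. X i = x i} = emeasure (IT.CI {0..<n}) {restrict x {0..<n}}"
      by (simp add: L_def IT.lim single)
    also have "\<dots> = emeasure (IT.C 0 n (\<lambda>_. undefined))
        (IT.PF.emb {0..<n} {0..<n} {restrict x {0..<n}})"
      by (intro IT.emeasure_CI single) auto
    also have "IT.PF.emb {0..<n} {0..<n} {restrict x {0..<n}} = {restrict x {0..<n}}"
      by (intro prod_emb_id) (auto simp: M_def PiE_iff)
    finally show ?thesis .
  qed
  have step: "emeasure (IT.C 0 (Suc n) (\<lambda>_. undefined)) {restrict x {0..<Suc n}} =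
      emeasure (P n (restrict x {0..<n})) {x n} *
      emeasure (IT.C 0 n (\<lambda>_. undefined)) {restrict x {0..<n}}" for x n
  proof -
    let ?C = "IT.C 0 n (\<lambda>_. undefined)"
    have u: "(\<lambda>_. undefined) \<in> space (PiM {0..<0} M)" by (simp add: space_PiM)
    have spC: "space ?C = space (PiM {0..<n} M)" using IT.space_C[OF u, of n] by simp
    have sC: "sets ?C = sets (PiM {0..<n} M)" using IT.sets_C[OF u, of n] by simp
    have ne: "space ?C \<noteq> {}" unfolding spC by (simp add: space_PiM PiE_eq_empty_iff M_def)
    have eP: "IT.eP n \<in> measurable ?C (subprob_algebra (PiM {0..<Suc n} M))"
      using IT.measurable_eP[of n] measurable_cong_sets[OF sC refl] by blast
    have "emeasure (IT.C 0 (Suc n) (\<lambda>_. undefined)) {restrict x {0..<Suc n}} =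
        (\<integral>\<^sup>+ \<omega>. emeasure (IT.eP n \<omega>) {restrict x {0..<Suc n}} \<partial>?C)"
      using emeasure_bind[OF ne eP single] by simp
    also have "\<dots> = (\<integral>\<^sup>+ \<omega>. emeasure (P n (restrict x {0..<n})) {x n} *
        indicator {restrict x {0..<n}} \<omega> \<partial>?C)"
    proof (intro nn_integral_cong)
      fix \<omega> assume "\<omega> \<in> space ?C"
      then have w: "\<omega> \<in> space (PiM {0..<n} M)" by (simp add: spC)
      then have ext: "\<omega> \<in> extensional {0..<n}" by (simp add: space_PiM PiE_iff)
      have iff: "fun_upd \<omega> n y = restrict x {0..<Suc n} \<longleftrightarrow> \<omega> = restrict x {0..<n} \<and> y = x n" for y
      proof
        assume *: "fun_upd \<omega> n y = restrict x {0..<Suc n}"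
        have "\<omega> i = restrict x {0..<n} i" for i
          using fun_cong[OF *, of i] ext by (cases "i = n") (auto simp: extensional_def restrict_def)
        moreover have "y = x n" using fun_cong[OF *, of n] by simp
        ultimately show "\<omega> = restrict x {0..<n} \<and> y = x n" by auto
      qed (auto simp: fun_eq_iff restrict_def)
      have "emeasure (IT.eP n \<omega>) {restrict x {0..<Suc n}} =
          emeasure (P n \<omega>) ((\<lambda>y. fun_upd \<omega> n y) -` {restrict x {0..<Suc n}} \<inter> space (M n))"
        by (intro IT.emeasure_eP w single)
      also have "(\<lambda>y. fun_upd \<omega> n y) -` {restrict x {0..<Suc n}} \<inter> space (M n) =
          (if \<omega> = restrict x {0..<n} then {x n} else {})"
        unfolding vimage_def mem_Collect_eq singleton_iff iff by (auto simp: M_def)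
      finally show "emeasure (IT.eP n \<omega>) {restrict x {0..<Suc n}} =
          emeasure (P n (restrict x {0..<n})) {x n} * indicator {restrict x {0..<n}} \<omega>"
        by (cases "\<omega> = restrict x {0..<n}") (simp_all only: if_True if_False indicator_simps
            singleton_iff mult_1_right mult_zero_right emeasure_empty simp_thms)
    qed
    also have "\<dots> = emeasure (P n (restrict x {0..<n})) {x n} * emeasure ?C {restrict x {0..<n}}"
      using single sC by (intro nn_integral_cmult_indicator) auto
    finally show ?thesis .
  qed
  have base: "emeasure L {X. \<forall>i<0. X i = x i} = 1" for x :: "nat \<Rightarrow> 's"
    unfolding path using single[of x 0] by (simp add: restrict_def)
  have prob: "prob_space L"
    using base by (intro prob_spaceI) (simp add: spL)
  interpret L: prob_space L by (rule prob)
  have init: "measure L {X. X 0 = s} = 1"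
  proof -
    have "emeasure L {X. \<forall>i<Suc 0. X i = s} = 1"
      using step[of 0 "\<lambda>_. s"] base[of "\<lambda>_. s"] unfolding path
      by (simp add: P_def emeasure_pmf_single del: IT.C.simps)
    then show ?thesis by (simp add: L.emeasure_eq_measure)
  qed
  have trans: "measure L {X. \<forall>i\<le>Suc n. X i = x i} =
      pmf (K (x n)) (x (Suc n)) * measure L {X. \<forall>i\<le>n. X i = x i}" for n x
  proof -
    have "emeasure L {X. \<forall>i<Suc (Suc n). X i = x i} =
        ennreal (pmf (K (x n)) (x (Suc n))) * emeasure L {X. \<forall>i<Suc n. X i = x i}"
      using step[of "Suc n" x] unfolding path
      by (simp add: P_def emeasure_pmf_single del: IT.C.simps)
    then show ?thesis
      by (simp add: L.emeasure_eq_measure less_Suc_eq_le flip: ennreal_mult)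
  qed
  have "markov_chain_law (\<lambda>v. pmf (K v)) s L"
    unfolding markov_chain_law_def
  proof (intro conjI allI impI prob S)
    show "\<P>(X in L. X 0 = s) = 1" using init by (simp add: spL)
    fix n x u
    assume nz: "\<P>(X in L. \<forall>i\<le>n. X i = x i) \<noteq> 0"
    have "{X. X (Suc n) = u \<and> (\<forall>i\<le>n. X i = x i)} = {X. \<forall>i\<le>Suc n. X i = (fun_upd x (Suc n) u) i}"
      by (auto simp: le_Suc_eq)
    moreover have "{X. \<forall>i\<le>n. X i = (fun_upd x (Suc n) u) i} = {X. \<forall>i\<le>n. X i = x i}"
      by auto
    ultimately show "\<P>(X in L. X (Suc n) = u \<bar> \<forall>i\<le>n. X i = x i) = pmf (K (x n)) u"
      using trans[of n "fun_upd x (Suc n) u"] nz by (simp add: cond_prob_def spL)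
  qed
  then show ?thesis by blast
qed

lemma gap_positive: "gap e \<omega> = enat k \<Longrightarrow> k > 0"
proof (rule ccontr)
  assume g: "gap e \<omega> = enat k" and "\<not> k > 0"
  have "1 \<le> gap e \<omega>"
    unfolding gap_def by (intro INF_greatest) (auto simp: one_enat_def)
  with g \<open>\<not> k > 0\<close> show False by (simp add: one_enat_def)
qed

lemma gap_point:
  assumes "gap e \<omega> = enat k"
  shows "\<omega> (int k * e)"
proof -
  let ?S = "enat ` {k::nat. k > 0 \<and> \<omega> (int k * e)}"
  have "?S \<noteq> {}"
  proof
    assume "?S = {}"
    then have "gap e \<omega> = \<infinity>" unfolding gap_def by (simp only: Inf_empty top_enat_def)
    with assms show False by simp
  qed
  then have "Inf ?S \<in> ?S" by (metis wellorder_InfI ex_in_conv)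
  then show ?thesis using assms by (auto simp: gap_def)
qed

lemma card_neighbours:
  assumes "gap 1 (shift v \<omega>) < \<infinity>" "gap (-1) (shift v \<omega>) < \<infinity>"
  shows "card (neighbours \<omega> v) = 2"
proof -
  obtain k l where "gap 1 (shift v \<omega>) = enat k" "gap (-1) (shift v \<omega>) = enat l"
    using assms by auto
  with gap_positive[of 1 "shift v \<omega>" k] gap_positive[of "-1" "shift v \<omega>" l]
  show ?thesis by (auto simp: neighbours_def card_insert_if)
qed

lemma quenched_law_well_defined:
  assumes "\<And>v. gap 1 (shift v \<omega>) < \<infinity>" "\<And>v. gap (-1) (shift v \<omega>) < \<infinity>"
  shows "markov_chain_law (trans_prob \<omega>) 0 (quenched_law \<omega>)"
    and "\<exists>!L. markov_chain_law (trans_prob \<omega>) 0 L"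
proof -
  have "trans_prob \<omega> = (\<lambda>v. pmf (pmf_of_set (neighbours \<omega> v)))"
  proof (intro ext)
    fix v u
    have "neighbours \<omega> v \<noteq> {}" "finite (neighbours \<omega> v)" by (auto simp: neighbours_def)
    then show "trans_prob \<omega> v u = pmf (pmf_of_set (neighbours \<omega> v)) u"
      using card_neighbours[OF assms] by (simp add: trans_prob_def)
  qed
  then have "\<exists>L. markov_chain_law (trans_prob \<omega>) 0 L"
    using markov_chain_law_exists[of "\<lambda>v. pmf_of_set (neighbours \<omega> v)"] by simp
  then show *: "\<exists>!L. markov_chain_law (trans_prob \<omega>) 0 L"
    using markov_chain_law_unique by blast
  show "markov_chain_law (trans_prob \<omega>) 0 (quenched_law \<omega>)"
    unfolding quenched_law_def by (rule theI'[OF *])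
qed

lemma quenched_law_in_points:
  assumes fin: "\<And>v. gap 1 (shift v \<omega>) < \<infinity>" "\<And>v. gap (-1) (shift v \<omega>) < \<infinity>"
    and "\<omega> \<in> Omega0"
  shows "AE X in quenched_law \<omega>. \<forall>n. X n \<in> points \<omega>"
proof -
  let ?L = "quenched_law \<omega>"
  have L: "markov_chain_law (trans_prob \<omega>) 0 ?L" by (rule quenched_law_well_defined(1)[OF fin])
  interpret L: prob_space ?L using L by (simp add: markov_chain_law_def)
  have S: "sets ?L = sets (\<Pi>\<^sub>M n\<in>UNIV. count_space UNIV)"
    using L by (simp add: markov_chain_law_def)
  have nb: "neighbours \<omega> v \<subseteq> points \<omega>" for v
  proof -
    obtain k l where "gap 1 (shift v \<omega>) = enat k" "gap (-1) (shift v \<omega>) = enat l"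
      using fin[of v] by auto
    with gap_point[of 1 "shift v \<omega>" k] gap_point[of "-1" "shift v \<omega>" l]
    show ?thesis by (auto simp: neighbours_def points_def shift_def)
  qed
  have "AE X in ?L. \<not> (\<forall>i\<le>n. X i = l ! i)" if "l ! n \<notin> points \<omega>" for l n
  proof -
    have "\<P>(X in ?L. \<forall>i\<le>n. X i = l ! i) = 0"
    proof (cases n)
      case 0
      then show ?thesis
        using path_prob[OF L, of n "\<lambda>i. l ! i"] that \<open>\<omega> \<in> Omega0\<close>
        by (auto simp: points_def Omega0_def)
    next
      case (Suc m)
      then have "trans_prob \<omega> (l ! m) (l ! Suc m) = 0"
        using that nb by (auto simp: trans_prob_def)
      then show ?thesis
        using path_prob[OF L, of n "\<lambda>i. l ! i"] Suc by simp
    qed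
    then show ?thesis
      by (simp only: L.prob_Collect_eq_0[OF path_sets(1)[OF S]])
  qed
  then have "AE X in ?L. \<forall>p\<in>{(n, l). l ! n \<notin> points \<omega>}. \<not> (\<forall>i\<le>fst p. X i = snd p ! i)"
    by (subst AE_ball_countable) auto
  then show ?thesis
  proof eventually_elim
    case (elim X)
    show ?case
    proof (rule allI, rule ccontr)
      fix n assume "X n \<notin> points \<omega>"
      then show False
        using elim[rule_format, of "(n, map X [0..<Suc n])"] by (auto simp del: upt_Suc)
    qed
  qed
qed

end

theory Submission
  imports Defs "HOL-Real_Asymp.Real_Asymp"
begin

text \<open>
  If \<open>\<dots> < t (-1) < t 0 = 0 < t 1 < \<dots>\<close> enumerates the points of \<open>\<omega>\<close>, then the walk is
  \<open>X\<^sub>n = t (S\<^sub>n)\<close> for a simple random walk \<open>S\<close> on \<open>\<int>\<close>. Birkhoff's theorem for \<open>\<theta>\<^sub>1\<close> and \<open>\<theta>\<^sub>-\<^sub>1\<close>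
  gives the points density \<open>Q \<Omega>\<^sub>0\<close> on both half-lines, hence \<open>t k / k \<longlonglongrightarrow> 1 / Q \<Omega>\<^sub>0\<close> as
  \<open>k\<close> tends to \<open>\<plusminus>\<infinity>\<close>, and \<open>1 / Q \<Omega>\<^sub>0 = E\<^sub>P f\<^sub>1\<close> by Kac's formula. So \<open>t (S\<^sub>n)\<close> and
  \<open>E\<^sub>P f\<^sub>1 \<cdot> S\<^sub>n\<close> differ by \<open>o(\<surd>n)\<close> in \<open>L\<^sup>1\<close>, and comparing characteristic functions with
  \<open>(cos (u / \<surd>n))\<^sup>n \<longlonglongrightarrow> exp (-u\<^sup>2 / 2)\<close> yields the limit law.
\<close>

section \<open>The ergodic theorem\<close>

definition birkhoff_sum :: "('a \<Rightarrow> 'a) \<Rightarrow> ('a \<Rightarrow> real) \<Rightarrow> nat \<Rightarrow> 'a \<Rightarrow> real" where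
  "birkhoff_sum T f n x = (\<Sum>i<n. f ((T ^^ i) x))"

lemma birkhoff_sum_0 [simp]: "birkhoff_sum T f 0 x = 0"
  by (simp add: birkhoff_sum_def)

lemma birkhoff_sum_Suc: "birkhoff_sum T f (Suc n) x = f x + birkhoff_sum T f n (T x)"
  by (simp add: birkhoff_sum_def sum.lessThan_Suc_shift funpow_Suc_right del: sum.lessThan_Suc funpow.simps)

lemma birkhoff_sum_diff_const:
  "birkhoff_sum T (\<lambda>x. f x - c) n x = birkhoff_sum T f n x - real n * c"
  by (simp add: birkhoff_sum_def sum_subtractf)

text \<open>This is the maximum of \<open>birkhoff_sum T f n x\<close> over all \<open>n\<close> up
  to \<open>N\<close>, the empty sum 0 included, in the recursive form that Garsia's argument
  uses.\<close>

primrec max_birkhoff_sum :: "('a \<Rightarrow> 'a) \<Rightarrow> ('a \<Rightarrow> real) \<Rightarrow> nat \<Rightarrow> 'a \<Rightarrow> real" where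
  "max_birkhoff_sum T f 0 x = 0"
| "max_birkhoff_sum T f (Suc N) x = max 0 (f x + max_birkhoff_sum T f N (T x))"

lemma max_birkhoff_sum_nonneg: "0 \<le> max_birkhoff_sum T f N x"
  by (cases N) auto

lemma max_birkhoff_sum_mono_Suc: "max_birkhoff_sum T f N x \<le> max_birkhoff_sum T f (Suc N) x"
proof (induction N arbitrary: x)
  case (Suc N)
  show ?case using Suc[of "T x"] by (simp add: max_def)
qed simp

lemma birkhoff_sum_le_max: "n \<le> N \<Longrightarrow> birkhoff_sum T f n x \<le> max_birkhoff_sum T f N x"
proof (induction N arbitrary: n x)
  case (Suc N)
  show ?case
  proof (cases n)
    case 0
    then show ?thesis by (simp add: max_birkhoff_sum_nonneg)
  next
    case (Suc m)
    then have "birkhoff_sum T f m (T x) \<le> max_birkhoff_sum T f N (T x)"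
      using Suc.IH[of m "T x"] Suc.prems by simp
    then show ?thesis by (simp add: Suc birkhoff_sum_Suc)
  qed
qed simp

context
  fixes M :: "'a measure" and T :: "'a \<Rightarrow> 'a"
  assumes stat: "stationary T M"
begin

lemma stationary_measurable: "T \<in> M \<rightarrow>\<^sub>M M"
  using stat by (simp add: stationary_def)

lemma integrable_stationary:
  fixes g :: "'a \<Rightarrow> real"
  assumes "integrable M g"
  shows "integrable M (\<lambda>x. g (T x))"
  using assms stat integrable_distr[of T M M g] by (simp add: stationary_def)

lemma integral_stationary:
  fixes g :: "'a \<Rightarrow> real"
  assumes "integrable M g"
  shows "(\<integral>x. g (T x) \<partial>M) = (\<integral>x. g x \<partial>M)"
  using assms stat integral_distr[of T M M g] by (auto simp: stationary_def)

lemma integrable_max_birkhoff_sum: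
  assumes "integrable M f"
  shows "integrable M (max_birkhoff_sum T f N)"
proof (induction N)
  case 0
  then show ?case by simp
next
  case (Suc N)
  have "integrable M (\<lambda>x. max 0 (f x + max_birkhoff_sum T f N (T x)))"
    by (intro integrable_max Bochner_Integration.integrable_add assms integrable_stationary[OF Suc]) auto
  then show ?case by simp
qed

text \<open>Garsia's argument: on the set where the maximal sum \<open>m (Suc N)\<close> is positive it equals
  \<open>f + m N \<circ> T\<close>, and \<open>m N \<circ> T\<close> has the same integral as \<open>m N \<le> m (Suc N)\<close>.\<close>

lemma maximal_ergodic:
  assumes f: "integrable M f"
    and pos: "AE x in M. \<exists>n. birkhoff_sum T f n x > 0"
  shows "0 \<le> (\<integral>x. f x \<partial>M)"
proof -
  let ?m = "max_birkhoff_sum T f"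
  let ?g = "\<lambda>N x. f x * indicator {x. ?m (Suc N) x > 0} x"
  note m = integrable_max_birkhoff_sum[OF f]
  have [measurable]: "?m N \<in> borel_measurable M" for N using m by auto
  have [measurable]: "f \<in> borel_measurable M" using f by auto
  have g: "integrable M (?g N)" for N
    by (rule Bochner_Integration.integrable_bound[OF f])
       (auto simp: indicator_def simp del: max_birkhoff_sum.simps)
  have "0 \<le> (\<integral>x. ?g N x \<partial>M)" for N
  proof -
    have "(\<integral>x. ?m (Suc N) x \<partial>M) \<le> (\<integral>x. ?g N x + ?m N (T x) \<partial>M)"
    proof (intro integral_mono m Bochner_Integration.integrable_add g integrable_stationary)
      \<comment> \<open>Equality where \<open>?m (Suc N) x\<close> is positive; elsewhere the left
        side is 0 and the right side is \<open>?m N (T x)\<close>.\<close>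
      show "?m (Suc N) x \<le> ?g N x + ?m N (T x)" for x
        using max_birkhoff_sum_nonneg[of T f N "T x"] by (auto simp: indicator_def max_def)
    qed
    also have "\<dots> = (\<integral>x. ?g N x \<partial>M) + (\<integral>x. ?m N x \<partial>M)"
      by (simp add: g integrable_stationary m integral_stationary del: max_birkhoff_sum.simps)
    also have "(\<integral>x. ?m N x \<partial>M) \<le> (\<integral>x. ?m (Suc N) x \<partial>M)"
      by (intro integral_mono m max_birkhoff_sum_mono_Suc)
    finally show ?thesis by simp
  qed
  \<comment> \<open>By \<open>pos\<close>, almost every point eventually stays in the sets where the
    maximal sum is positive, so the cut-off functions tend to \<open>f\<close>, dominated by its
    norm.\<close>
  moreover have "(\<lambda>N. \<integral>x. ?g N x \<partial>M) \<longlonglongrightarrow> (\<integral>x. f x \<partial>M)"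
  proof (rule integral_dominated_convergence[where w="\<lambda>x. norm (f x)"])
    show "AE x in M. (\<lambda>N. ?g N x) \<longlonglongrightarrow> f x"
      using pos
    proof eventually_elim
      case (elim x)
      then obtain n where n: "birkhoff_sum T f n x > 0" by blast
      have "\<forall>\<^sub>F N in sequentially. ?g N x = f x"
        using eventually_ge_at_top[of n]
      proof eventually_elim
        case (elim N)
        then have "?m (Suc N) x > 0"
          using birkhoff_sum_le_max[of n "Suc N" T f x] n by linarith
        then show ?case by (simp del: max_birkhoff_sum.simps)
      qed
      then show ?case by (rule tendsto_eventually)
    qed
    show "integrable M (\<lambda>x. norm (f x))" using f by simp
    show "?g N \<in> borel_measurable M" for N using g by auto
    show "AE x in M. norm (?g N x) \<le> norm (f x)" for N
      by (simp add: indicator_def del: max_birkhoff_sum.simps)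
  qed auto
  ultimately show ?thesis by (meson LIMSEQ_le_const)
qed

section \<open>From the maximal inequality to almost sure convergence\<close>

lemma birkhoff_sum_measurable:
  assumes "f \<in> borel_measurable M"
  shows "birkhoff_sum T f n \<in> borel_measurable M"
proof -
  have "(T ^^ i) \<in> M \<rightarrow>\<^sub>M M" for i
    by (induction i) (simp_all add: measurable_comp[OF _ stationary_measurable] del: comp_apply)
  then show ?thesis
    unfolding birkhoff_sum_def[abs_def]
    by (intro borel_measurable_sum measurable_compose[OF _ assms])
qed

text \<open>The set where the Birkhoff sums of \<open>f - c\<close> are unbounded above is exactly invariant,
  which avoids any null-set bookkeeping.\<close>

lemma birkhoff_upper:
  assumes "prob_space M" and erg: "ergodic T M" and f: "integrable M f"
    and c: "(\<integral>x. f x \<partial>M) < c"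
  shows "AE x in M. \<exists>K. \<forall>n. birkhoff_sum T f n x \<le> K + real n * c"
proof -
  interpret prob_space M by fact
  let ?g = "\<lambda>x. f x - c"
  \<comment> \<open>Natural thresholds \<open>K\<close> keep \<open>E\<close> measurable;
    \<open>unb\<close> passes to real thresholds, which may be shifted by \<open>?g x\<close> in the
    invariance proof.\<close>
  define E where "E = {x\<in>space M. \<forall>K::nat. \<exists>n. birkhoff_sum T ?g n x > real K}"
  have [measurable]: "birkhoff_sum T ?g n \<in> borel_measurable M" for n
    using f by (intro birkhoff_sum_measurable) auto
  have E: "E \<in> sets M" unfolding E_def by measurable
  have unb: "(\<forall>K::nat. \<exists>n. birkhoff_sum T ?g n x > real K) \<longleftrightarrow>
     (\<forall>K::real. \<exists>n. birkhoff_sum T ?g n x > K)" for x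
    by (meson order.strict_trans reals_Archimedean2)
  have "(\<forall>K::real. \<exists>n. birkhoff_sum T ?g n (T x) > K) \<longleftrightarrow>
        (\<forall>K::real. \<exists>n. birkhoff_sum T ?g n x > K)" (is "?l \<longleftrightarrow> ?r") for x
  proof
    assume l: ?l
    show ?r
    proof
      fix K
      obtain n where "birkhoff_sum T ?g n (T x) > K - ?g x" using l by blast
      then have "birkhoff_sum T ?g (Suc n) x > K" by (simp add: birkhoff_sum_Suc)
      then show "\<exists>n. birkhoff_sum T ?g n x > K" ..
    qed
  next
    assume r: ?r
    show ?l
    proof
      fix K
      \<comment> \<open>The \<open>max\<close> with 0 excludes \<open>n = 0\<close>, whose sum is
        empty, so that a first term can be split off.\<close>
      obtain n where n: "birkhoff_sum T ?g n x > max 0 (K + ?g x)" using r by blast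
      then obtain m where "n = Suc m" by (cases n) auto
      with n have "birkhoff_sum T ?g m (T x) > K" by (simp add: birkhoff_sum_Suc)
      then show "\<exists>n. birkhoff_sum T ?g n (T x) > K" ..
    qed
  qed
  then have "T -` E \<inter> space M = E"
    using measurable_space[OF stationary_measurable] unfolding E_def unb by auto
  then have "prob E = 0 \<or> prob E = 1"
    using erg E by (simp add: ergodic_def)
  moreover have "prob E \<noteq> 1"
  proof
    assume "prob E = 1"
    then have "AE x in M. x \<in> E" using E by (simp add: prob_eq_1)
    then have "AE x in M. \<exists>n. birkhoff_sum T ?g n x > 0"
      by eventually_elim (force simp: E_def unb)
    then have "0 \<le> (\<integral>x. ?g x \<partial>M)"
      using f by (intro maximal_ergodic) auto
    also have "\<dots> = (\<integral>x. f x \<partial>M) - c" using f by (simp add: prob_space)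
    finally show False using c by simp
  qed
  ultimately have "AE x in M. x \<notin> E" using E by (simp add: prob_eq_0)
  then show ?thesis
    using AE_space
  proof eventually_elim
    case (elim x)
    then show ?case
      unfolding E_def birkhoff_sum_diff_const by (auto simp: not_less algebra_simps)
  qed
qed

text \<open>The margins \<open>1 / (j + 1)\<close> yield one null set for all \<open>e\<close>; the
  additive constant vanishes after division by \<open>n\<close>.\<close>

lemma birkhoff_upper_eventually:
  assumes "prob_space M" and "ergodic T M" and "integrable M f"
  shows "AE x in M. \<forall>e>0. \<forall>\<^sub>F n in sequentially.
    birkhoff_sum T f n x / real n < (\<integral>x. f x \<partial>M) + e"
proof -
  let ?I = "\<integral>x. f x \<partial>M"
  have "AE x in M. \<forall>j. \<exists>K. \<forall>n. birkhoff_sum T f n x \<le> K + real n * (?I + 1 / real (Suc j))"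
    unfolding AE_all_countable by (intro allI birkhoff_upper assms) simp
  then show ?thesis
  proof eventually_elim
    case (elim x)
    show ?case
    proof (intro allI impI)
      fix e :: real assume "e > 0"
      then obtain j where j: "1 / real (Suc j) < e / 2"
        by (metis half_gt_zero inverse_eq_divide reals_Archimedean)
      obtain K where K: "\<And>n. birkhoff_sum T f n x \<le> K + real n * (?I + 1 / real (Suc j))"
        using elim by blast
      have "(\<lambda>n. K / real n) \<longlonglongrightarrow> 0" by real_asymp
      then have "\<forall>\<^sub>F n in sequentially. K / real n < e / 2"
        by (rule order_tendstoD) (use \<open>e > 0\<close> in simp)
      then show "\<forall>\<^sub>F n in sequentially. birkhoff_sum T f n x / real n < ?I + e"
        using eventually_gt_at_top[of 0]
      proof eventually_elim
        case (elim n)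
        have "birkhoff_sum T f n x / real n \<le> (K + real n * (?I + 1 / real (Suc j))) / real n"
          using K by (intro divide_right_mono) auto
        also have "\<dots> = K / real n + (?I + 1 / real (Suc j))"
          using elim by (simp add: add_divide_distrib)
        finally show ?case using elim j by linarith
      qed
    qed
  qed
qed

text \<open>The lower bound is the upper bound for \<open>- f\<close>.\<close>

theorem birkhoff_ergodic:
  assumes "prob_space M" and "ergodic T M" and f: "integrable M f"
  shows "AE x in M. (\<lambda>n. birkhoff_sum T f n x / real n) \<longlonglongrightarrow> (\<integral>x. f x \<partial>M)"
proof -
  have neg: "birkhoff_sum T (\<lambda>x. - f x) n x = - birkhoff_sum T f n x" for n x
    by (simp add: birkhoff_sum_def sum_negf)
  have "AE x in M. \<forall>e>0. \<forall>\<^sub>F n in sequentially.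
      birkhoff_sum T (\<lambda>x. - f x) n x / real n < (\<integral>x. - f x \<partial>M) + e"
    using assms by (intro birkhoff_upper_eventually) auto
  with birkhoff_upper_eventually[OF assms] show ?thesis
  proof eventually_elim
    case (elim x)
    show ?case
    proof (rule tendstoI)
      fix e :: real assume "e > 0"
      with elim have "\<forall>\<^sub>F n in sequentially. birkhoff_sum T f n x / real n < (\<integral>x. f x \<partial>M) + e"
        "\<forall>\<^sub>F n in sequentially. - birkhoff_sum T f n x / real n < - (\<integral>x. f x \<partial>M) + e"
        by (auto simp: neg)
      then show "\<forall>\<^sub>F n in sequentially. dist (birkhoff_sum T f n x / real n) (\<integral>x. f x \<partial>M) < e"
        by eventually_elim (auto simp: dist_real_def)
    qed
  qed
qed

end

section \<open>Simple random walk\<close>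

fun srw_pmf :: "nat \<Rightarrow> int pmf" where
  "srw_pmf 0 = return_pmf 0"
| "srw_pmf (Suc n) = srw_pmf n \<bind> (\<lambda>k. pmf_of_set {k + 1, k - 1})"

lemma finite_set_srw_pmf: "finite (set_pmf (srw_pmf n))"
  by (induction n) auto

text \<open>Conditioning on the position before the last step; moments and characteristic functions
  then follow by induction on time.\<close>

lemma expectation_srw_Suc:
  fixes h :: "int \<Rightarrow> 'c::{banach, second_countable_topology}"
  shows "measure_pmf.expectation (srw_pmf (Suc n)) h =
    measure_pmf.expectation (srw_pmf n) (\<lambda>k. (h (k + 1) + h (k - 1)) /\<^sub>R 2)"
proof -
  have step: "measure_pmf.expectation (pmf_of_set {k + 1, k - 1}) h = (h (k + 1) + h (k - 1)) /\<^sub>R 2"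
    for k :: int
  proof -
    have "measure_pmf.expectation (pmf_of_set {k + 1, k - 1}) h =
        (\<Sum>a\<in>{k + 1, k - 1}. pmf (pmf_of_set {k + 1, k - 1}) a *\<^sub>R h a)"
      by (rule integral_measure_pmf) auto
    also have "\<dots> = (h (k + 1) + h (k - 1)) /\<^sub>R 2"
      by (simp add: scaleR_add_right)
    finally show ?thesis .
  qed
  have "measure_pmf.expectation (srw_pmf (Suc n)) h =
      (\<Sum>a\<in>set_pmf (srw_pmf n). pmf (srw_pmf n) a *\<^sub>R
        measure_pmf.expectation (pmf_of_set {a + 1, a - 1}) h)"
    unfolding srw_pmf.simps by (rule pmf_expectation_bind) (auto simp: finite_set_srw_pmf)
  also have "\<dots> = measure_pmf.expectation (srw_pmf n) (\<lambda>k. (h (k + 1) + h (k - 1)) /\<^sub>R 2)"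
    unfolding step by (rule integral_measure_pmf[symmetric]) (auto simp: finite_set_srw_pmf)
  finally show ?thesis .
qed

lemma integrable_srw [simp]:
  fixes h :: "int \<Rightarrow> 'c::{banach, second_countable_topology}"
  shows "integrable (measure_pmf (srw_pmf n)) h"
  by (intro integrable_measure_pmf_finite finite_set_srw_pmf)

lemma srw_second_moment: "measure_pmf.expectation (srw_pmf n) (\<lambda>k. (real_of_int k)\<^sup>2) = real n"
proof (induction n)
  case (Suc n)
  have "((real_of_int (k + 1))\<^sup>2 + (real_of_int (k - 1))\<^sup>2) /\<^sub>R 2 = (real_of_int k)\<^sup>2 + 1" for k
    by (simp add: power2_eq_square algebra_simps)
  then show ?case unfolding expectation_srw_Suc using Suc by simp
qed simp

lemma srw_char:
  "measure_pmf.expectation (srw_pmf n) (\<lambda>k. iexp (u * real_of_int k)) = of_real (cos u ^ n)"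
proof (induction n)
  case (Suc n)
  have "(iexp (u * real_of_int (k + 1)) + iexp (u * real_of_int (k - 1))) /\<^sub>R 2
      = of_real (cos u) * iexp (u * real_of_int k)" for k
  proof -
    have "iexp (u * real_of_int (k + 1)) = iexp (u * real_of_int k) * iexp u"
      "iexp (u * real_of_int (k - 1)) = iexp (u * real_of_int k) * iexp (- u)"
      by (simp_all add: algebra_simps flip: exp_add)
    then have "iexp (u * real_of_int (k + 1)) + iexp (u * real_of_int (k - 1)) =
        iexp (u * real_of_int k) * (iexp u + iexp (- u))"
      by (simp only: distrib_left)
    also have "iexp u + iexp (- u) = of_real (2 * cos u)"
      unfolding cis_conv_exp[symmetric] by (simp add: complex_eq_iff)
    finally show ?thesis by (simp add: scaleR_conv_of_real)
  qed
  then show ?case unfolding expectation_srw_Suc using Suc by simp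
qed simp

section \<open>Asymptotics of characteristic functions\<close>

lemma cos_power_tendsto: "(\<lambda>n. cos (u / sqrt (real n)) ^ n) \<longlonglongrightarrow> exp (- u\<^sup>2 / 2)"
proof (cases "u = 0")
  case False
  then have "(\<lambda>n. cos (u / sqrt (real n)) ^ n) \<longlonglongrightarrow> exp (- (u * u / 2))" by real_asymp
  then show ?thesis by (simp add: power2_eq_square)
qed simp

lemma norm_iexp_diff_le: "norm (iexp x - iexp y) \<le> \<bar>x - y\<bar>"
proof -
  have "iexp x = iexp y * iexp (x - y)"
    by (subst exp_add[symmetric]) (simp add: algebra_simps)
  then have "iexp x - iexp y = iexp y * (iexp (x - y) - 1)"
    by (simp only: right_diff_distrib mult_1_right)
  then have "norm (iexp x - iexp y) = norm (iexp (x - y) - 1)"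
    by (simp only: norm_mult norm_exp_i_times mult_1_left)
  then show ?thesis using iexp_approx1[of "x - y" 0] by simp
qed

text \<open>The bound \<open>z <= (z^2 + 1) / 2\<close> for
  \<open>z = \<bar>y\<bar> / sqrt n\<close> trades the absolute value for the square, whose
  expectation under the walk is known exactly.\<close>

lemma norm_iexp_linear_error:
  fixes n :: nat and x y e C u a :: real
  assumes xy: "\<bar>x - a * y\<bar> \<le> e * \<bar>y\<bar> + C" and n: "n > 0" and e: "e \<ge> 0"
  shows "norm (iexp (u * (x / sqrt (real n))) - iexp (a * u / sqrt (real n) * y))
    \<le> \<bar>u\<bar> * e / 2 * (y\<^sup>2 / real n + 1) + \<bar>u\<bar> * C / sqrt (real n)"
proof -
  let ?s = "sqrt (real n)"
  have s: "?s > 0" using n by simp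
  define z where "z = \<bar>y\<bar> / ?s"
  have z: "z \<le> (y\<^sup>2 / real n + 1) / 2"
    using sum_squares_bound[of z 1] by (simp add: z_def power_divide mult.commute)
  have "norm (iexp (u * (x / ?s)) - iexp (a * u / ?s * y)) \<le> \<bar>u * (x / ?s) - a * u / ?s * y\<bar>"
    by (rule norm_iexp_diff_le)
  also have "\<dots> = \<bar>u * (x - a * y) / ?s\<bar>"
    using s by (simp add: diff_divide_distrib right_diff_distrib mult_ac)
  also have "\<dots> = \<bar>u\<bar> * \<bar>x - a * y\<bar> / ?s"
    using s by (simp add: abs_mult)
  also have "\<dots> \<le> \<bar>u\<bar> * (e * \<bar>y\<bar> + C) / ?s"
    using xy s by (intro divide_right_mono mult_left_mono) auto
  also have "\<dots> = \<bar>u\<bar> * e * z + \<bar>u\<bar> * C / ?s"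
    by (simp add: z_def add_divide_distrib distrib_left mult_ac)
  also have "\<dots> \<le> \<bar>u\<bar> * e * ((y\<^sup>2 / real n + 1) / 2) + \<bar>u\<bar> * C / ?s"
    using z e by (intro add_right_mono mult_left_mono) auto
  finally show ?thesis by simp
qed

lemma norm_srw_diff_le:
  fixes f g :: "int \<Rightarrow> 'c::{banach, second_countable_topology}"
  assumes "\<And>k. norm (f k - g k) \<le> h k"
  shows "norm (measure_pmf.expectation (srw_pmf n) f - measure_pmf.expectation (srw_pmf n) g)
    \<le> measure_pmf.expectation (srw_pmf n) h"
proof -
  have "norm (measure_pmf.expectation (srw_pmf n) (\<lambda>k. f k - g k))
      \<le> measure_pmf.expectation (srw_pmf n) (\<lambda>k. norm (f k - g k))"
    by (rule integral_norm_bound)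
  also have "\<dots> \<le> measure_pmf.expectation (srw_pmf n) h"
    by (rule integral_mono[OF integrable_srw integrable_srw]) (rule assms)
  finally show ?thesis by simp
qed

text \<open>A path functional \<open>t\<close> with linear growth rate \<open>a\<close> inherits the central limit theorem:
  the error \<open>\<bar>t k - a k\<bar> \<le> e \<bar>k\<bar> + C\<close> is negligible on the scale \<open>\<surd>n\<close> since \<open>E \<bar>S\<^sub>n\<bar> \<le> \<surd>n\<close>.\<close>

lemma srw_image_char_tendsto:
  fixes t :: "int \<Rightarrow> real"
  assumes lin: "\<And>e. e > 0 \<Longrightarrow> \<exists>C. \<forall>k. \<bar>t k - a * real_of_int k\<bar> \<le> e * \<bar>real_of_int k\<bar> + C"
  shows "(\<lambda>n. measure_pmf.expectation (srw_pmf n) (\<lambda>k. iexp (u * (t k / sqrt (real n)))))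
    \<longlonglongrightarrow> of_real (exp (- (a * u)\<^sup>2 / 2))"
proof -
  let ?E = "\<lambda>n. measure_pmf.expectation (srw_pmf n)"
  let ?f = "\<lambda>n k. iexp (u * (t k / sqrt (real n)))"
  let ?g = "\<lambda>n k. iexp (a * u / sqrt (real n) * real_of_int k)"
  have g: "(\<lambda>n. ?E n (?g n) :: complex) \<longlonglongrightarrow> of_real (exp (- (a * u)\<^sup>2 / 2))"
    unfolding srw_char by (intro tendsto_of_real cos_power_tendsto)
  have "(\<lambda>n. ?E n (?f n) - ?E n (?g n)) \<longlonglongrightarrow> 0"
  proof (rule tendstoI)
    fix r :: real assume r: "r > 0"
    \<comment> \<open>The \<open>+ 1\<close> covers \<open>u = 0\<close>. As the second moment is
      \<open>n\<close>, the linear error costs \<open>\<bar>u\<bar> * e < r / 2\<close>; the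
      constant \<open>C\<close> costs less than the other half for large \<open>n\<close>.\<close>
    define e where "e = r / (2 * (\<bar>u\<bar> + 1))"
    have e: "e > 0" "\<bar>u\<bar> * e < r / 2" using r by (auto simp: e_def pos_divide_less_eq)
    obtain C where C: "\<And>k. \<bar>t k - a * real_of_int k\<bar> \<le> e * \<bar>real_of_int k\<bar> + C"
      using lin[OF e(1)] by blast
    have "(\<lambda>n. \<bar>u\<bar> * C / sqrt (real n)) \<longlonglongrightarrow> 0" by real_asymp
    then have "\<forall>\<^sub>F n in sequentially. \<bar>u\<bar> * C / sqrt (real n) < r / 2"
      using r by (intro order_tendstoD(2)[of _ 0]) auto
    then show "\<forall>\<^sub>F n in sequentially. dist (?E n (?f n) - ?E n (?g n)) 0 < r"
      using eventually_gt_at_top[of 0]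
    proof eventually_elim
      case (elim n)
      let ?s = "sqrt (real n)"
      have pw: "norm (?f n k - ?g n k) \<le>
          \<bar>u\<bar> * e / 2 * ((real_of_int k)\<^sup>2 / real n + 1) + \<bar>u\<bar> * C / ?s" for k
        using C elim e(1) by (intro norm_iexp_linear_error) auto
      have "norm (?E n (?f n) - ?E n (?g n)) \<le>
          measure_pmf.expectation (srw_pmf n)
            (\<lambda>k. \<bar>u\<bar> * e / 2 * ((real_of_int k)\<^sup>2 / real n + 1) + \<bar>u\<bar> * C / ?s)"
        by (rule norm_srw_diff_le[OF pw])
      also have "\<dots> = \<bar>u\<bar> * e / 2 *
          (measure_pmf.expectation (srw_pmf n) (\<lambda>k. (real_of_int k)\<^sup>2) / real n + 1) + \<bar>u\<bar> * C / ?s"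
        by simp
      also have "\<dots> = \<bar>u\<bar> * e + \<bar>u\<bar> * C / ?s"
        using elim by (simp add: srw_second_moment)
      finally show ?case unfolding dist_norm diff_0_right using elim(1) e(2) by linarith
    qed
  qed
  from tendsto_add[OF this g] show ?thesis by simp
qed

text \<open>Scaling the standard normal law by \<sigma> evaluates its characteristic function at
  \<open>\<sigma> * u\<close>.\<close>

lemma char_normal_density:
  assumes "\<sigma> > 0"
  shows "char (density lborel (normal_density 0 \<sigma>)) u = of_real (exp (- (\<sigma> * u)\<^sup>2 / 2))"
proof -
  interpret std: prob_space std_normal_distribution by (rule prob_space_normal_density) simp
  have "distributed std_normal_distribution lborel (\<lambda>x. x) std_normal_density"
    by (auto simp: distributed_def intro!: distr_id2)
  from std.normal_density_affine[OF this, of \<sigma> 0] assms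
  have "distr std_normal_distribution lborel (\<lambda>x. \<sigma> * x) = density lborel (normal_density 0 \<sigma>)"
    by (simp add: distributed_def)
  then have "char (density lborel (normal_density 0 \<sigma>)) u =
      (CLINT x|distr std_normal_distribution lborel (\<lambda>x. \<sigma> * x). iexp (u * x))"
    unfolding char_def by simp
  also have "\<dots> = (CLINT x|std_normal_distribution. iexp (u * (\<sigma> * x)))"
    by (rule integral_distr) auto
  also have "\<dots> = char std_normal_distribution (\<sigma> * u)"
    unfolding char_def by (simp add: algebra_simps)
  finally show ?thesis by (simp add: char_std_normal_distribution)
qed

section \<open>Marginals of Markov chains\<close>

text \<open>Total probability, used below both for whole histories and for the last position
  alone.\<close>

lemma emeasure_split_countable:
  fixes g :: "'a \<Rightarrow> 'b::countable"
  assumes g: "\<And>v. {x\<in>space M. g x = v} \<in> sets M" and A: "A \<in> sets M"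
  shows "emeasure M A = (\<integral>\<^sup>+v. emeasure M (A \<inter> {x\<in>space M. g x = v}) \<partial>count_space UNIV)"
proof -
  have "A = (\<Union>v. A \<inter> {x\<in>space M. g x = v})"
    using sets.sets_into_space[OF A] by auto
  then have "emeasure M A = emeasure M (\<Union>v. A \<inter> {x\<in>space M. g x = v})" by simp
  also have "\<dots> = (\<integral>\<^sup>+v. emeasure M (A \<inter> {x\<in>space M. g x = v}) \<partial>count_space UNIV)"
    using g A by (intro emeasure_UN_countable) (auto simp: disjoint_family_on_def)
  finally show ?thesis .
qed

definition chain_pmf :: "('s \<Rightarrow> 's pmf) \<Rightarrow> 's \<Rightarrow> nat \<Rightarrow> 's pmf" where
  "chain_pmf K s n = ((\<lambda>p. p \<bind> K) ^^ n) (return_pmf s)"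

lemma chain_pmf_simps [simp]:
  "chain_pmf K s 0 = return_pmf s"
  "chain_pmf K s (Suc n) = chain_pmf K s n \<bind> K"
  by (simp_all add: chain_pmf_def)

text \<open>Transports the simple random walk along the enumeration of the points: a map that
  intertwines the kernels intertwines their iterates.\<close>

lemma map_chain_pmf:
  assumes "\<And>k. map_pmf t (K k) = K' (t k)"
  shows "map_pmf t (chain_pmf K s n) = chain_pmf K' (t s) n"
proof (induction n)
  case (Suc n)
  then show ?case
    by (simp add: map_bind_pmf assms flip: Suc) (simp add: bind_map_pmf)
qed simp

text \<open>The definition of \<open>markov_chain_law\<close> conditions on complete histories, so a
  transition given only the last position is obtained by summing over histories.\<close>

lemma markov_chain_marginal:
  fixes K :: "'s::countable \<Rightarrow> 's pmf"
  assumes L: "markov_chain_law (\<lambda>v. pmf (K v)) s L"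
  shows "distr L (count_space UNIV) (\<lambda>X. X n) = measure_pmf (chain_pmf K s n)"
proof -
  interpret prob_space L using L by (simp add: markov_chain_law_def)
  have S: "sets L = sets (\<Pi>\<^sub>M n\<in>UNIV. count_space UNIV)"
    using L by (simp add: markov_chain_law_def)
  have sp: "space L = UNIV"
    using sets_eq_imp_space_eq[OF S] by (auto simp: space_PiM)
  have [measurable]: "(\<lambda>X. X n) \<in> measurable L (count_space UNIV)" for n
    using measurable_cong_sets[OF S refl] measurable_component_singleton[of n UNIV] by blast
  note ps = path_sets[OF S, unfolded sp, simplified]
  have point: "emeasure L {X. X n = u} = ennreal (pmf (chain_pmf K s n) u)" for u n
  proof (induction n arbitrary: u)
    case 0
    have init: "\<P>(X in L. X 0 = s) = 1"
      using L by (simp add: markov_chain_law_def)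
    then have "AE X in L. X 0 = s" using path_sets(3)[OF S, of 0 s] by (simp add: prob_Collect_eq_1)
    then have "emeasure L {X. X 0 = u} = emeasure L (if u = s then UNIV else {})"
      by (intro emeasure_eq_AE) (use ps(3) sp sets.top[of L] in \<open>auto elim!: eventually_mono\<close>)
    then show ?case using emeasure_space_1 by (simp add: sp pmf_return)
  next
    case (Suc n)
    \<comment> \<open>The history up to time \<open>n\<close>, as a list so that it ranges over a
      countable type.\<close>
    let ?g = "\<lambda>X::nat \<Rightarrow> 's. map X [0..<Suc n]"
    have g_iff: "?g X = l \<longleftrightarrow> length l = Suc n \<and> (\<forall>i\<le>n. X i = l ! i)" for X l
      by (auto simp: list_eq_iff_nth_eq less_Suc_eq_le simp del: upt_Suc)
    have g: "{X\<in>space L. ?g X = l} \<in> sets L" for l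
      unfolding g_iff sp using ps(1)[of n "\<lambda>i. l ! i"] by (cases "length l = Suc n") auto
    have step: "emeasure L ({X. X (Suc n) = u} \<inter> {X\<in>space L. X n = v}) =
        ennreal (pmf (K v) u) * emeasure L {X. X n = v}" for v
    proof -
      have "emeasure L ({X. X (Suc n) = u} \<inter> {X\<in>space L. X n = v} \<inter> {X\<in>space L. ?g X = l}) =
          ennreal (pmf (K v) u) * emeasure L ({X. X n = v} \<inter> {X\<in>space L. ?g X = l})" for l
      proof (cases "length l = Suc n \<and> l ! n = v")
        case True
        \<comment> \<open>The history \<open>l\<close> extended by \<open>u\<close>: the path
          probabilities at \<open>Suc n\<close> and \<open>n\<close> differ by the one factor
          \<open>pmf (K v) u\<close>.\<close>
        define x where "x = (\<lambda>i. (l @ [u]) ! i)"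
        have x: "x i = l ! i" if "i \<le> n" for i using True that by (simp add: x_def nth_append)
        have xS: "x (Suc n) = u" using True by (simp add: x_def nth_append)
        have e1: "{X. X (Suc n) = u} \<inter> {X\<in>space L. X n = v} \<inter> {X\<in>space L. ?g X = l} =
            {X. \<forall>i\<le>Suc n. X i = x i}"
          unfolding g_iff sp using True x xS by (auto simp: le_Suc_eq)
        have e2: "{X. X n = v} \<inter> {X\<in>space L. ?g X = l} = {X. \<forall>i\<le>n. X i = x i}"
          unfolding g_iff sp using True x by auto
        have "measure L {X. \<forall>i\<le>Suc n. X i = x i} = pmf (K v) u * measure L {X. \<forall>i\<le>n. X i = x i}"
          using path_prob[OF L, of "Suc n" x] path_prob[OF L, of n x] True x[of n] xS
          by (simp add: sp)
        then show ?thesis unfolding e1 e2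
          by (simp add: emeasure_eq_measure flip: ennreal_mult)
      next
        case False
        then have "{X. X n = v} \<inter> {X\<in>space L. ?g X = l} = {}"
          "{X. X (Suc n) = u} \<inter> {X\<in>space L. X n = v} \<inter> {X\<in>space L. ?g X = l} = {}"
          unfolding g_iff by auto
        then show ?thesis by (simp only: emeasure_empty mult_zero_right)
      qed
      then show ?thesis
        using ps(3) sp
        by (subst (1 2) emeasure_split_countable[OF g])
           (auto simp: nn_integral_cmult simp del: upt_Suc)
    qed
    have "emeasure L {X. X (Suc n) = u} =
        (\<integral>\<^sup>+v. emeasure L ({X. X (Suc n) = u} \<inter> {X\<in>space L. X n = v}) \<partial>count_space UNIV)"
      using ps(3) by (intro emeasure_split_countable) (auto simp: sp)
    also have "\<dots> = (\<integral>\<^sup>+v. ennreal (pmf (chain_pmf K s n) v) * ennreal (pmf (K v) u) \<partial>count_space UNIV)"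
      unfolding step Suc by (simp add: mult.commute)
    also have "\<dots> = ennreal (pmf (chain_pmf K s (Suc n)) u)"
      by (simp add: ennreal_pmf_bind nn_integral_measure_pmf)
    finally show ?case .
  qed
  show ?thesis
    by (rule measure_eqI_countable[of _ UNIV])
       (auto simp: emeasure_distr vimage_def sp point emeasure_pmf_single)
qed

lemma srw_pmf_eq_chain_pmf: "srw_pmf n = chain_pmf (\<lambda>k. pmf_of_set {k + 1, k - 1}) 0 n"
  by (induction n) auto

section \<open>Enumeration of the points\<close>

lemma gap_eqI:
  assumes "n > 0" "\<omega> (int n * e)" "\<And>k. 0 < k \<Longrightarrow> k < n \<Longrightarrow> \<not> \<omega> (int k * e)"
  shows "gap e \<omega> = enat n"
  unfolding gap_def
proof (rule antisym)
  show "(INF k\<in>{k. 0 < k \<and> \<omega> (int k * e)}. enat k) \<le> enat n"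
    by (rule INF_lower) (use assms in auto)
  show "enat n \<le> (INF k\<in>{k. 0 < k \<and> \<omega> (int k * e)}. enat k)"
    by (rule INF_greatest) (use assms(3) not_less in auto)
qed

lemma gap_finite:
  assumes "n > 0" "\<omega> (int n * e)"
  shows "gap e \<omega> < \<infinity>"
proof -
  have "gap e \<omega> \<le> enat n"
    unfolding gap_def by (rule INF_lower) (use assms in auto)
  then show ?thesis by (metis enat_ord_code(4) le_less_trans)
qed

text \<open>No integer lies strictly between consecutive indices, so no point lies strictly between
  consecutive values of \<open>t\<close>, and the gaps are their differences.\<close>

lemma neighbours_enumeration:
  fixes t :: "int \<Rightarrow> int"
  assumes t: "strict_mono t" and rng: "range t = points \<omega>"
  shows "neighbours \<omega> (t k) = {t (k + 1), t (k - 1)}"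
proof -
  have pt: "\<omega> (t j)" for j using rng by (auto simp: points_def)
  have between: "\<not> \<omega> x" if "t j < x" "x < t (j + 1)" for j x
  proof
    assume "\<omega> x"
    then obtain i where "x = t i" using rng by (auto simp: points_def)
    with that show False using strict_mono_less[OF t] by auto
  qed
  have lt: "t (k - 1) < t k" "t k < t (k + 1)" using t by (auto simp: strict_mono_less)
  have "gap 1 (shift (t k) \<omega>) = enat (nat (t (k + 1) - t k))"
  proof (rule gap_eqI)
    fix i assume "0 < i" "i < nat (t (k + 1) - t k)"
    then show "\<not> shift (t k) \<omega> (int i * 1)"
      using between[of k "t k + int i"] by (simp add: shift_def)
  qed (use lt pt in \<open>auto simp: shift_def\<close>)
  moreover have "gap (-1) (shift (t k) \<omega>) = enat (nat (t k - t (k - 1)))"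
  proof (rule gap_eqI)
    fix i assume "0 < i" "i < nat (t k - t (k - 1))"
    then show "\<not> shift (t k) \<omega> (int i * (-1))"
      using between[of "k - 1" "t k - int i"] by (simp add: shift_def)
  qed (use lt pt in \<open>auto simp: shift_def\<close>)
  ultimately show ?thesis using lt by (simp add: neighbours_def)
qed

text \<open>Two one-sided enumerations glued at the origin. If \<open>\<omega> 0\<close> holds, both
  have entry 0 at index 0, which negative \<open>k\<close> skip, so the origin is listed
  once.\<close>

definition point_enum :: "env \<Rightarrow> int \<Rightarrow> int" where
  "point_enum \<omega> k =
     (if k \<ge> 0 then int (enumerate {n. \<omega> (int n)} (nat k))
      else - int (enumerate {n. \<omega> (- int n)} (nat (- k))))"

context
  fixes \<omega> :: env
  assumes origin: "\<omega> 0"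
    and inf_right: "infinite {n. \<omega> (int n)}"
    and inf_left: "infinite {n. \<omega> (- int n)}"
begin

lemma enumerate_origin [simp]:
  "enumerate {n. \<omega> (int n)} 0 = 0" "enumerate {n. \<omega> (- int n)} 0 = 0"
  using origin by (auto simp: enumerate_0 intro!: Least_eq_0)

lemma point_enum_0 [simp]: "point_enum \<omega> 0 = 0"
  by (simp add: point_enum_def)

lemma strict_mono_point_enum: "strict_mono (point_enum \<omega>)"
proof (rule strict_monoI)
  fix k l :: int assume "k < l"
  consider "k \<ge> 0" | "k < 0" "l \<ge> 0" | "l < 0" by linarith
  then show "point_enum \<omega> k < point_enum \<omega> l"
  proof cases
    case 2
    then have "enumerate {n. \<omega> (- int n)} 0 < enumerate {n. \<omega> (- int n)} (nat (- k))"
      using inf_left by (intro enumerate_mono) auto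
    then show ?thesis using 2 by (simp add: point_enum_def)
  qed (use \<open>k < l\<close> inf_left inf_right in \<open>auto simp: point_enum_def\<close>)
qed

lemma range_point_enum: "range (point_enum \<omega>) = points \<omega>"
proof (intro equalityI subsetI)
  fix x assume "x \<in> range (point_enum \<omega>)"
  then show "x \<in> points \<omega>"
    using enumerate_in_set[OF inf_right] enumerate_in_set[OF inf_left]
    by (auto simp: point_enum_def points_def split: if_splits)
next
  fix x assume x: "x \<in> points \<omega>"
  show "x \<in> range (point_enum \<omega>)"
  proof (cases "x \<ge> 0")
    case True
    with x have "nat x \<in> {n. \<omega> (int n)}" by (simp add: points_def)
    then obtain n where "enumerate {n. \<omega> (int n)} n = nat x"
      using enumerate_Ex[OF inf_right] by blast
    then have "point_enum \<omega> (int n) = x" using True by (simp add: point_enum_def)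
    then show ?thesis by (metis rangeI)
  next
    case False
    with x have "nat (- x) \<in> {n. \<omega> (- int n)}" by (simp add: points_def)
    then obtain n where n: "enumerate {n. \<omega> (- int n)} n = nat (- x)"
      using enumerate_Ex[OF inf_left] by blast
    \<comment> \<open>Index 0 gives the origin, but \<open>x\<close> is negative; hence
      \<open>- int n\<close> falls in the negative branch of \<open>point_enum\<close>.\<close>
    then have "n \<noteq> 0" using False by (intro notI) simp
    then have "point_enum \<omega> (- int n) = x" using False n by (simp add: point_enum_def)
    then show ?thesis by (metis rangeI)
  qed
qed

section \<open>The walk on the points as an image of the simple random walk\<close>

lemma gap_shift_finite: "gap 1 (shift v \<omega>) < \<infinity>" "gap (-1) (shift v \<omega>) < \<infinity>"
proof -
  obtain n where "nat v < n" "\<omega> (int n)" using inf_right by (auto simp: infinite_nat_iff_unbounded)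
  then show "gap 1 (shift v \<omega>) < \<infinity>"
    by (intro gap_finite[of "nat (int n - v)"]) (auto simp: shift_def)
  obtain n where "nat (- v) < n" "\<omega> (- int n)" using inf_left by (auto simp: infinite_nat_iff_unbounded)
  then show "gap (-1) (shift v \<omega>) < \<infinity>"
    by (intro gap_finite[of "nat (v + int n)"]) (auto simp: shift_def)
qed

lemma quenched_law_chain:
  "markov_chain_law (\<lambda>v. pmf (pmf_of_set (neighbours \<omega> v))) 0 (quenched_law \<omega>)"
proof -
  have "trans_prob \<omega> = (\<lambda>v. pmf (pmf_of_set (neighbours \<omega> v)))"
  proof (intro ext)
    fix v u
    have "neighbours \<omega> v \<noteq> {}" "finite (neighbours \<omega> v)" by (auto simp: neighbours_def)
    then show "trans_prob \<omega> v u = pmf (pmf_of_set (neighbours \<omega> v)) u"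
      using card_neighbours[OF gap_shift_finite] by (simp add: trans_prob_def)
  qed
  then show ?thesis using quenched_law_well_defined(1)[OF gap_shift_finite] by simp
qed

text \<open>The injective enumeration carries the uniform law on \<open>{k + 1, k - 1}\<close> to
  the uniform law on the two neighbours. Equality of the laws at each time suffices for the limit
  theorem; no coupling of trajectories is built.\<close>

lemma quenched_marginal:
  "distr (quenched_law \<omega>) (count_space UNIV) (\<lambda>X. X n) =
     measure_pmf (map_pmf (point_enum \<omega>) (srw_pmf n))"
proof -
  have "map_pmf (point_enum \<omega>) (pmf_of_set {k + 1, k - 1}) =
      pmf_of_set (neighbours \<omega> (point_enum \<omega> k))" for k
    unfolding neighbours_enumeration[OF strict_mono_point_enum range_point_enum]
    using strict_mono_imp_inj_on[OF strict_mono_point_enum, of "{k + 1, k - 1}"]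
    by (subst map_pmf_of_set_inj) simp_all
  then show ?thesis
    unfolding srw_pmf_eq_chain_pmf
    by (subst map_chain_pmf[where K' = "\<lambda>v. pmf_of_set (neighbours \<omega> v)"])
       (simp_all add: markov_chain_marginal[OF quenched_law_chain])
qed

text \<open>By Levy's continuity theorem it is enough to treat characteristic functions, and these
  see only the law of \<open>X n\<close>.\<close>

theorem quenched_clt:
  assumes "a > 0"
    and lin: "\<And>e. e > 0 \<Longrightarrow>
      \<exists>C. \<forall>k. \<bar>real_of_int (point_enum \<omega> k) - a * real_of_int k\<bar> \<le> e * \<bar>real_of_int k\<bar> + C"
  shows "weak_conv_m (\<lambda>n. distr (quenched_law \<omega>) borel (\<lambda>X. real_of_int (X n) / sqrt (real n)))
    (density lborel (normal_density 0 a))"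
proof (rule levy_continuity)
  let ?L = "quenched_law \<omega>"
  interpret prob_space ?L using quenched_law_chain by (simp add: markov_chain_law_def)
  have S: "sets ?L = sets (\<Pi>\<^sub>M n\<in>UNIV. count_space UNIV)"
    using quenched_law_chain by (simp add: markov_chain_law_def)
  have coord: "(\<lambda>X. X n) \<in> ?L \<rightarrow>\<^sub>M count_space UNIV" for n
    using measurable_cong_sets[OF S refl] measurable_component_singleton[of n UNIV] by blast
  have meas: "(\<lambda>X. real_of_int (X n) / sqrt (real n)) \<in> borel_measurable ?L" for n
    using measurable_compose[OF coord[of n], of "\<lambda>v. real_of_int v / sqrt (real n)" borel] by simp
  show "real_distribution (distr ?L borel (\<lambda>X. real_of_int (X n) / sqrt (real n)))" for n
    using meas by (simp add: real_distribution_def real_distribution_axioms_def prob_space_distr)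
  show "real_distribution (density lborel (normal_density 0 a))"
    using prob_space_normal_density[OF assms(1)]
    by (simp add: real_distribution_def real_distribution_axioms_def)
  fix u
  have "char (distr ?L borel (\<lambda>X. real_of_int (X n) / sqrt (real n))) u =
      measure_pmf.expectation (srw_pmf n)
        (\<lambda>k. iexp (u * (real_of_int (point_enum \<omega> k) / sqrt (real n))))" for n
  proof -
    have "char (distr ?L borel (\<lambda>X. real_of_int (X n) / sqrt (real n))) u =
        (CLINT X|?L. iexp (u * (real_of_int (X n) / sqrt (real n))))"
      unfolding char_def by (subst integral_distr[OF meas]) auto
    also have "\<dots> = (CLINT v|distr ?L (count_space UNIV) (\<lambda>X. X n). iexp (u * (real_of_int v / sqrt (real n))))"
      by (subst integral_distr[OF coord]) auto
    also have "\<dots> = measure_pmf.expectation (srw_pmf n)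
        (\<lambda>k. iexp (u * (real_of_int (point_enum \<omega> k) / sqrt (real n))))"
      unfolding quenched_marginal by simp
    finally show ?thesis .
  qed
  then show "(\<lambda>n. char (distr ?L borel (\<lambda>X. real_of_int (X n) / sqrt (real n))) u)
      \<longlonglongrightarrow> char (density lborel (normal_density 0 a)) u"
    unfolding char_normal_density[OF assms(1)] using srw_image_char_tendsto[OF lin, of u] by simp
qed

end

section \<open>Growth of the enumeration\<close>

text \<open>The counts of a finite set are bounded by its cardinality, which forces density
  0.\<close>

lemma infinite_of_positive_density:
  fixes A :: "nat set"
  assumes "(\<lambda>m. real (card (A \<inter> {..<m})) / real m) \<longlonglongrightarrow> q" "q > 0"
  shows "infinite A"
proof
  assume A: "finite A"
  have "(\<lambda>m. real (card (A \<inter> {..<m})) / real m) \<longlonglongrightarrow> 0"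
  proof (rule tendsto_sandwich[where f = "\<lambda>_. 0"])
    show "(\<lambda>m. real (card A) / real m) \<longlonglongrightarrow> 0" by real_asymp
    show "\<forall>\<^sub>F m in sequentially. real (card (A \<inter> {..<m})) / real m \<le> real (card A) / real m"
      using A by (intro always_eventually allI divide_right_mono) (auto intro: card_mono)
  qed auto
  with assms show False using LIMSEQ_unique by force
qed

text \<open>Along \<open>m = enumerate A n\<close> the count below \<open>m\<close> is exactly
  \<open>n\<close>, since indices start at 0 and \<open>m\<close> itself is excluded; the limit is
  then inverted.\<close>

lemma enumerate_density:
  fixes A :: "nat set"
  assumes dens: "(\<lambda>m. real (card (A \<inter> {..<m})) / real m) \<longlonglongrightarrow> q" and q: "q > 0"
  shows "(\<lambda>n. real (enumerate A n) / real n) \<longlonglongrightarrow> 1 / q"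
proof -
  have A: "infinite A" using assms by (rule infinite_of_positive_density)
  have "A \<inter> {..<enumerate A n} = enumerate A ` {..<n}" for n
    using enumerate_Ex[OF A] enumerate_in_set[OF A] A by (force simp: image_iff)
  moreover have "card (enumerate A ` {..<n}) = n" for n
    using inj_enumerate[OF A] by (subst card_image) (auto intro: inj_on_subset)
  ultimately have "(\<lambda>n. real n / real (enumerate A n)) \<longlonglongrightarrow> q"
    using LIMSEQ_subseq_LIMSEQ[OF dens strict_mono_enumerate[OF A]] by (simp add: comp_def)
  from tendsto_inverse[OF this] q show ?thesis by (simp add: inverse_eq_divide)
qed

lemma linear_growth_bound:
  fixes x :: "nat \<Rightarrow> real"
  assumes lim: "(\<lambda>n. x n / real n) \<longlonglongrightarrow> a" and e: "e > 0"
  shows "\<exists>C. \<forall>n. \<bar>x n - a * real n\<bar> \<le> e * real n + C"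
proof -
  obtain N where N: "\<And>n. n \<ge> N \<Longrightarrow> \<bar>x n / real n - a\<bar> < e"
    using LIMSEQ_D[OF lim e] by auto
  show ?thesis
  proof (intro exI allI)
    fix n
    \<comment> \<open>Dominates each of the finitely many early errors. Index 0 always counts as
      early, so the other case may divide by \<open>n\<close>.\<close>
    let ?C = "\<Sum>m\<le>N. \<bar>x m - a * real m\<bar>"
    have C: "?C \<ge> 0" by (simp add: sum_nonneg)
    show "\<bar>x n - a * real n\<bar> \<le> e * real n + ?C"
    proof (cases "n \<le> N")
      case True
      then have "\<bar>x n - a * real n\<bar> \<le> ?C" by (intro member_le_sum) auto
      moreover have "e * real n \<ge> 0" using e by simp
      ultimately show ?thesis by linarith
    next
      case False
      then have n: "real n > 0" by simp
      have "\<bar>x n - a * real n\<bar> = real n * \<bar>x n / real n - a\<bar>"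
        using n by (simp add: abs_mult_pos' field_simps flip: abs_mult_pos)
      also have "\<dots> \<le> real n * e" using N[of n] False by (intro mult_left_mono) auto
      finally show ?thesis using C by (subst (2) mult.commute) linarith
    qed
  qed
qed

lemma point_enum_growth:
  assumes "(\<lambda>m. real (card ({n. \<omega> (int n)} \<inter> {..<m})) / real m) \<longlonglongrightarrow> q"
    and "(\<lambda>m. real (card ({n. \<omega> (- int n)} \<inter> {..<m})) / real m) \<longlonglongrightarrow> q"
    and "q > 0" and e: "e > 0"
  shows "\<exists>C. \<forall>k. \<bar>real_of_int (point_enum \<omega> k) - 1 / q * real_of_int k\<bar>
    \<le> e * \<bar>real_of_int k\<bar> + C"
proof -
  obtain C where C: "\<And>n. \<bar>real (enumerate {n. \<omega> (int n)} n) - 1 / q * real n\<bar> \<le> e * real n + C"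
    using linear_growth_bound[OF enumerate_density[OF assms(1,3)] e] by blast
  obtain D where D: "\<And>n. \<bar>real (enumerate {n. \<omega> (- int n)} n) - 1 / q * real n\<bar> \<le> e * real n + D"
    using linear_growth_bound[OF enumerate_density[OF assms(2,3)] e] by blast
  show ?thesis
  proof (intro exI allI)
    fix k
    show "\<bar>real_of_int (point_enum \<omega> k) - 1 / q * real_of_int k\<bar>
      \<le> e * \<bar>real_of_int k\<bar> + max C D"
      using C[of "nat k"] D[of "nat (- k)"]
      by (cases "k \<ge> 0") (auto simp: point_enum_def abs_minus_commute)
  qed
qed

section \<open>Stationary ergodic environments\<close>

lemma stationary_funpow:
  assumes "stationary T M"
  shows "stationary (T ^^ n) M"
proof (induction n)
  case 0
  then show ?case by (simp add: stationary_def distr_id2 id_def)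
next
  case (Suc n)
  have "distr M M (T \<circ> (T ^^ n)) = distr (distr M M (T ^^ n)) M T"
    using assms Suc by (intro distr_distr[symmetric]) (auto simp: stationary_def)
  then show ?case
    using assms Suc by (simp add: stationary_def measurable_comp[of "T ^^ n" M M T M] del: comp_apply)
qed

text \<open>Replacing \<open>M\<close> by its image under \<open>T\<close> turns the image under
  \<open>S\<close> into the image under the identity.\<close>

lemma stationary_inverse:
  assumes "stationary T M" and S: "S \<in> M \<rightarrow>\<^sub>M M" and inv: "\<And>x. S (T x) = x"
  shows "stationary S M"
proof -
  have "distr M M S = distr (distr M M T) M S"
    using assms by (simp add: stationary_def)
  also have "\<dots> = distr M M (S \<circ> T)"
    using assms by (intro distr_distr) (auto simp: stationary_def)
  also have "\<dots> = M" by (simp add: comp_def inv distr_id2)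
  finally show ?thesis using S by (simp add: stationary_def)
qed

text \<open>An \<open>S\<close>-invariant set contains \<open>T x\<close> exactly when it contains
  \<open>S (T x) = x\<close>, so it is \<open>T\<close>-invariant. This makes the ergodic theorem
  available on the left half-line.\<close>

lemma ergodic_inverse:
  assumes erg: "ergodic T M" and "space M = UNIV" and inv: "\<And>x. S (T x) = x"
  shows "ergodic S M"
  unfolding ergodic_def
proof (intro ballI impI)
  fix A assume A: "A \<in> sets M" and "S -` A \<inter> space M = A"
  then have "T x \<in> A \<longleftrightarrow> S (T x) \<in> A" for x using assms(2) by auto
  then have "T -` A \<inter> space M = A" using assms(2) by (auto simp: inv)
  then show "measure M A = 0 \<or> measure M A = 1" using erg A by (auto simp: ergodic_def)
qed

section \<open>The environment space and its shifts\<close>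

lemma space_env_algebra [simp]: "space env_algebra = UNIV"
  by (simp add: env_algebra_def space_PiM)

lemma measurable_env_coordinate: "(\<lambda>\<omega>. \<omega> x) \<in> env_algebra \<rightarrow>\<^sub>M count_space UNIV"
  unfolding env_algebra_def by (rule measurable_component_singleton) simp

lemma measurable_shift: "shift x \<in> env_algebra \<rightarrow>\<^sub>M env_algebra"
  unfolding env_algebra_def shift_def[abs_def]
  by (intro measurable_PiM_single') (auto simp: measurable_component_singleton space_PiM)

lemma shift_shift: "shift x (shift y \<omega>) = shift (x + y) \<omega>"
  by (simp add: shift_def add_ac)

lemma shift_0 [simp]: "shift 0 \<omega> = \<omega>"
  by (simp add: shift_def)

lemma shift_funpow: "shift x ^^ n = shift (int n * x)"
proof (induction n)
  case (Suc n)
  have "shift x ((shift x ^^ n) \<omega>) = shift (int (Suc n) * x) \<omega>" for \<omega>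
    unfolding Suc shift_shift by (simp add: algebra_simps)
  then show ?case by (simp add: fun_eq_iff)
qed (simp add: fun_eq_iff)

lemma enat_less_gap_iff: "enat t < gap 1 \<omega> \<longleftrightarrow> (\<forall>k\<in>{1..t}. \<not> \<omega> (int k))"
proof
  assume t: "enat t < gap 1 \<omega>"
  show "\<forall>k\<in>{1..t}. \<not> \<omega> (int k)"
  proof (intro ballI notI)
    fix k assume "k \<in> {1..t}" "\<omega> (int k)"
    then have "gap 1 \<omega> \<le> enat k" "enat k \<le> enat t"
      unfolding gap_def by (auto intro: INF_lower)
    with t show False by (meson leD order_trans)
  qed
next
  assume *: "\<forall>k\<in>{1..t}. \<not> \<omega> (int k)"
  have "enat (Suc t) \<le> gap 1 \<omega>"
    unfolding gap_def by (rule INF_greatest) (use * in \<open>force simp: not_less_eq_eq\<close>)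
  then show "enat t < gap 1 \<omega>" by (metis Suc_ile_eq)
qed

text \<open>Writes the event that \<open>gap\<close> has a given value through countably many tail
  events, for measurability.\<close>

lemma enat_eq_iff_less: "c = d \<longleftrightarrow> (\<forall>t. enat t < c \<longleftrightarrow> enat t < d)"
  by (metis enat_ord_simps(4) enat_ord_simps(6) linorder_less_linear not_infinity_eq order_less_irrefl)

section \<open>Density of the points and Kac's formula\<close>

context
  fixes Q :: "env measure"
  assumes prob_Q: "prob_space Q"
    and sets_Q: "sets Q = sets env_algebra"
    and stat_Q: "stationary (shift 1) Q"
    and erg_Q: "ergodic (shift 1) Q"
    and nonempty_Q: "\<P>(\<omega> in Q. points \<omega> = {}) < 1"
begin

interpretation prob_space Q by (rule prob_Q)

lemma space_Q [simp]: "space Q = UNIV"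
  using sets_eq_imp_space_eq[OF sets_Q] by simp

lemma coordinate_Q [measurable]: "Measurable.pred Q (\<lambda>\<omega>. \<omega> x)"
  using measurable_env_coordinate measurable_cong_sets[OF sets_Q refl] by blast

lemma shift_Q: "shift x \<in> Q \<rightarrow>\<^sub>M Q"
  using measurable_shift measurable_cong_sets[OF sets_Q sets_Q] by blast

lemma Omega0_Q [measurable]: "Omega0 \<in> sets Q"
proof -
  have "{\<omega>\<in>space Q. \<omega> 0} \<in> sets Q" by measurable
  then show ?thesis by (simp add: Omega0_def)
qed

lemma stationary_shift: "stationary (shift x) Q"
proof -
  have "stationary (shift (-1)) Q"
    by (rule stationary_inverse[OF stat_Q shift_Q]) (simp add: shift_shift)
  then have "stationary (shift (- int n)) Q" for n
    using stationary_funpow[of "shift (-1)" Q n] by (simp add: shift_funpow)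
  moreover have "stationary (shift (int n)) Q" for n
    using stationary_funpow[OF stat_Q, of n] by (simp add: shift_funpow)
  ultimately show ?thesis by (cases x rule: int_cases2) auto
qed

lemma ergodic_shift_minus: "ergodic (shift (-1)) Q"
  by (rule ergodic_inverse[OF erg_Q]) (simp_all add: shift_shift)

lemma prob_shift: "A \<in> sets Q \<Longrightarrow> prob (shift x -` A) = prob A"
  using stationary_shift[of x] measure_distr[OF shift_Q, of A x] by (simp add: stationary_def)

text \<open>Were the origin almost surely empty, stationarity would empty every site, and countably
  many null sets would leave no points at all.\<close>

lemma prob_Omega0_pos: "prob Omega0 > 0"
proof (rule ccontr)
  assume "\<not> prob Omega0 > 0"
  then have "prob Omega0 = 0" using measure_nonneg[of Q Omega0] by linarith
  then have "prob {\<omega>\<in>space Q. \<omega> x} = 0" for x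
    using prob_shift[OF Omega0_Q, of x] by (simp add: vimage_def shift_def Omega0_def)
  then have "AE \<omega> in Q. \<not> \<omega> x" for x
    using prob_Collect_eq_0[OF coordinate_Q[of x, unfolded pred_def]] by simp
  then have "AE \<omega> in Q. \<forall>x. \<not> \<omega> x" by (simp add: AE_all_countable)
  then have "AE \<omega> in Q. points \<omega> = {}" by eventually_elim (simp add: points_def)
  moreover have "{\<omega>\<in>space Q. \<forall>x. \<not> \<omega> x} \<in> sets Q" by measurable
  then have "{\<omega>\<in>space Q. points \<omega> = {}} \<in> sets Q" by (simp only: points_def Collect_empty_eq)
  ultimately have "\<P>(\<omega> in Q. points \<omega> = {}) = 1" by (simp only: prob_Collect_eq_1)
  then show False using nonempty_Q by simp
qed

text \<open>The Birkhoff sum of the indicator of \<open>Omega0\<close> counts the points among the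
  first \<open>m\<close> multiples of \<open>x\<close>, starting with 0.\<close>

lemma density_along_shift:
  assumes "ergodic (shift x) Q"
  shows "AE \<omega> in Q. (\<lambda>m. real (card ({n. \<omega> (int n * x)} \<inter> {..<m})) / real m) \<longlonglongrightarrow> prob Omega0"
proof -
  have "birkhoff_sum (shift x) (indicator Omega0) m \<omega> = real (card ({n. \<omega> (int n * x)} \<inter> {..<m}))"
    for m \<omega>
  proof -
    have "birkhoff_sum (shift x) (indicator Omega0) m \<omega> = (\<Sum>i<m. indicator {n. \<omega> (int n * x)} i)"
      unfolding birkhoff_sum_def shift_funpow
      by (intro sum.cong) (auto simp: indicator_def Omega0_def shift_def)
    also have "\<dots> = real (card ({n. \<omega> (int n * x)} \<inter> {..<m}))"
      by (simp add: indicator_def sum_of_bool_eq Int_commute)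
    finally show ?thesis .
  qed
  moreover have "integrable Q (indicat_real Omega0)"
    by (simp add: emeasure_eq_measure)
  ultimately show ?thesis
    using birkhoff_ergodic[OF stationary_shift prob_Q assms, of "indicator Omega0"] by simp
qed

lemma density_right:
  "AE \<omega> in Q. (\<lambda>m. real (card ({n. \<omega> (int n)} \<inter> {..<m})) / real m) \<longlonglongrightarrow> prob Omega0"
  using density_along_shift[OF erg_Q] by simp

lemma density_left:
  "AE \<omega> in Q. (\<lambda>m. real (card ({n. \<omega> (- int n)} \<inter> {..<m})) / real m) \<longlonglongrightarrow> prob Omega0"
  using density_along_shift[OF ergodic_shift_minus] by simp

text \<open>Kac's formula. With \<open>b t\<close> the probability of seeing no point in \<open>{1..t}\<close>, stationarity gives
  \<open>Q (\<omega> 0 = 1, no point in {1..t}) = b t - b (t + 1)\<close>, and the tail sum telescopes.\<close>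

lemma mean_gap_eq: "mean_gap Q = ennreal (1 / prob Omega0)"
proof -
  define E where "E t = {\<omega>. \<forall>k\<in>{1..t::nat}. \<not> \<omega> (int k)}" for t
  have "{\<omega>\<in>space Q. \<forall>k\<in>{1..t}. \<not> \<omega> (int k)} \<in> sets Q" for t :: nat by measurable
  then have E [measurable]: "E t \<in> sets Q" for t by (simp add: E_def)
  have "prob (Omega0 \<inter> E t) = prob (E t) - prob (E (Suc t))" for t
  proof -
    \<comment> \<open>Seen from site 1, the window \<open>{1..t + 1}\<close> becomes
      \<open>{0..t}\<close>, and emptiness of its site 0 is the complement of
      \<open>Omega0\<close>.\<close>
    have "E (Suc t) = shift 1 -` (E t - Omega0)"
    proof -
      have "(\<forall>k\<in>{1..Suc t}. \<not> \<omega> (int k)) \<longleftrightarrow> \<not> \<omega> 1 \<and> (\<forall>k\<in>{1..t}. \<not> \<omega> (1 + int k))" for \<omega> :: env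
      proof -
        have "{1..Suc t} = insert 1 (Suc ` {1..t})" by (auto simp: image_Suc_atLeastAtMost)
        then show ?thesis by (simp del: image_Suc_atLeastAtMost)
      qed
      then show ?thesis by (auto simp: E_def Omega0_def shift_def)
    qed
    then have "prob (E (Suc t)) = prob (E t - Omega0)" by (simp add: prob_shift)
    moreover have "prob (E t - Omega0) = prob (E t) - prob (E t \<inter> Omega0)"
      by (rule finite_measure_Diff') auto
    ultimately show ?thesis by (simp add: Int_commute)
  qed
  \<comment> \<open>The intersection of the \<open>E t\<close> is the event of no point to the right
    of the origin, which is null because the density there is positive.\<close>
  moreover have "(\<lambda>t. prob (E t)) \<longlonglongrightarrow> 0"
  proof -
    have "(\<lambda>t. prob (E t)) \<longlonglongrightarrow> prob (\<Inter>t. E t)"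
    proof (rule finite_Lim_measure_decseq)
      show "range E \<subseteq> sets Q" using E by auto
      show "decseq E" by (auto simp: E_def decseq_def)
    qed
    moreover have "AE \<omega> in Q. \<omega> \<notin> (\<Inter>t. E t)"
      using density_right
    proof eventually_elim
      case (elim \<omega>)
      then have "infinite {n. \<omega> (int n)}" using prob_Omega0_pos by (rule infinite_of_positive_density)
      then obtain n where "n > 0" "\<omega> (int n)"
        by (auto simp: infinite_nat_iff_unbounded)
      then show ?case by (auto simp: E_def intro!: exI[of _ n])
    qed
    then have "prob (\<Inter>t. E t) = 0" by (subst prob_eq_0) auto
    ultimately show ?thesis by simp
  qed
  \<comment> \<open>The window for \<open>t = 0\<close> is empty, so the telescoping sum is
    \<open>1 - 0\<close>.\<close>
  moreover have "prob (E 0) = 1" using prob_space by (simp add: E_def)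
  ultimately have "(\<lambda>t. prob (Omega0 \<inter> E t)) sums 1"
    using telescope_sums'[of "\<lambda>t. prob (E t)" 0] by simp
  then have sums: "(\<lambda>t. prob (Omega0 \<inter> E t) / prob Omega0) sums (1 / prob Omega0)" by (rule sums_divide)
  have less_gap: "{\<omega>\<in>space Q. enat t < gap 1 \<omega>} = E t" for t
    by (simp add: enat_less_gap_iff E_def)
  have "gap 1 \<in> Q \<rightarrow>\<^sub>M count_space UNIV"
  proof (subst measurable_count_space_eq2_countable, safe)
    fix c
    have "gap 1 -` {c} \<inter> space Q = {\<omega>\<in>space Q. \<forall>t. (enat t < gap 1 \<omega>) = (enat t < c)}"
      by (auto simp: enat_eq_iff_less[of _ c])
    also have "\<dots> \<in> sets Q"
      unfolding enat_less_gap_iff by measurable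
    finally show "gap 1 -` {c} \<inter> space Q \<in> sets Q" .
  qed auto
  then have "gap 1 \<in> palm Q \<rightarrow>\<^sub>M count_space UNIV"
    by (simp add: palm_def uniform_measure_def)
  \<comment> \<open>The tail-sum formula for the expectation, valid also if the gap may be
    infinite.\<close>
  then have "mean_gap Q = (\<Sum>t. emeasure (palm Q) {\<omega>\<in>space (palm Q). enat t < gap 1 \<omega>})"
    unfolding mean_gap_def by (rule nn_integral_enat_function)
  also have "\<dots> = (\<Sum>t. ennreal (prob (Omega0 \<inter> E t) / prob Omega0))"
  proof (rule arg_cong[where f = suminf], rule ext)
    fix t
    have "{\<omega>\<in>space (palm Q). enat t < gap 1 \<omega>} = E t"
      using less_gap by (simp add: palm_def)
    then show "emeasure (palm Q) {\<omega>\<in>space (palm Q). enat t < gap 1 \<omega>} =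
        ennreal (prob (Omega0 \<inter> E t) / prob Omega0)"
      using prob_Omega0_pos by (simp add: palm_def emeasure_eq_measure divide_ennreal)
  qed
  also have "\<dots> = ennreal (1 / prob Omega0)"
    using sums by (intro suminf_ennreal_eq) auto
  finally show ?thesis .
qed

end

theorem theorem1p13:
  fixes Q :: "(int \<Rightarrow> bool) measure"
  assumes "prob_space Q"
    and "sets Q = sets env_algebra"
    and "stationary (shift 1) Q"
    and "ergodic (shift 1) Q"
    and "\<P>(\<omega> in Q. points \<omega> = {}) < 1"
  shows "mean_gap Q < \<infinity> \<and>
    (AE \<omega> in palm Q.
       weak_conv_m (\<lambda>n. distr (quenched_law \<omega>) borel (\<lambda>X. real_of_int (X n) / sqrt (real n)))
                   (density lborel (normal_density 0 (enn2real (mean_gap Q)))))"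
proof
  let ?q = "measure Q Omega0"
  note q = prob_Omega0_pos[OF assms]
  note mg = mean_gap_eq[OF assms]
  show "mean_gap Q < \<infinity>" by (simp add: mg)
  \<comment> \<open>By Kac's formula the limiting standard deviation equals the growth rate
    \<open>1 / ?q\<close> of the enumeration.\<close>
  have a: "enn2real (mean_gap Q) = 1 / ?q" using q by (simp add: mg)
  \<comment> \<open>Both density statements hold almost everywhere under \<open>Q\<close>;
    conditioning on \<open>Omega0\<close> comes last.\<close>
  have "AE \<omega> in Q. \<omega> \<in> Omega0 \<longrightarrow>
       weak_conv_m (\<lambda>n. distr (quenched_law \<omega>) borel (\<lambda>X. real_of_int (X n) / sqrt (real n)))
                   (density lborel (normal_density 0 (1 / ?q)))"
    using density_right[OF assms] density_left[OF assms]
  proof eventually_elim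
    case (elim \<omega>)
    show ?case
    proof
      assume "\<omega> \<in> Omega0"
      then show "weak_conv_m (\<lambda>n. distr (quenched_law \<omega>) borel (\<lambda>X. real_of_int (X n) / sqrt (real n)))
                   (density lborel (normal_density 0 (1 / ?q)))"
        using infinite_of_positive_density[OF elim(1) q] infinite_of_positive_density[OF elim(2) q] q
        by (intro quenched_clt point_enum_growth[OF elim q]) (auto simp: Omega0_def)
    qed
  qed
  then show "AE \<omega> in palm Q.
       weak_conv_m (\<lambda>n. distr (quenched_law \<omega>) borel (\<lambda>X. real_of_int (X n) / sqrt (real n)))
                   (density lborel (normal_density 0 (enn2real (mean_gap Q))))"
    unfolding palm_def a by (intro AE_uniform_measureI Omega0_Q[OF assms])
qed

end
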